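(* Assume $\lim_{n\to\infty}X'X/n=Q$ exists and is positive definite; partition $Q$ as $\begin{bmatrix}Q_{11}&Q_{12}\\Q_{21}&Q_{22}\end{bmatrix}$ conformably with $(k_1,k_2)$. (1) If $\beta^{(n)}$ is a sequence in $\mathbb{R}^k$ with $\|\sqrt n\beta_2^{(n)}\|\to\infty$, then the distribution of $\sqrt n(\tilde\beta-\beta^{(n)})$ under $\mathbb{P}_{n,\beta^{(n)},\sigma}$ converges weakly to $N(0,\sigma^2Q^{-1})$. (2) If $\sqrt n\beta_2^{(n)}\to\gamma\in\mathbb{R}^{k_2}$, then the distribution of $\sqrt n(\tilde\beta-\beta^{(n)})$ under $\mathbb{P}_{n,\beta^{(n)},\sigma}$ converges weakly to the distribution of $$B_\infty\gamma+C_\infty Z_1+\Big[1+\exp(2\alpha k_2)\exp\big(-\alpha\|Z_2+(Q_{22}-Q_{21}Q_{11}^{-1}Q_{12})^{1/2}\gamma\|^2/\sigma^2\big)\Big]^{-1}\{D_\infty Z_2-B_\infty\gamma\},$$ where $B_\infty=\begin{bmatrix}Q_{11}^{-1}Q_{12}\\-I_{k_2}\end{bmatrix}$, $C_\infty=\begin{bmatrix}Q_{11}^{-1/2}\\0_{k_2\times k_1}\end{bmatrix}$, $D_\infty=\begin{bmatrix}-Q_{11}^{-1}Q_{12}(Q_{22}-Q_{21}Q_{11}^{-1}Q_{12})^{-1/2}\\(Q_{22}-Q_{21}Q_{11}^{-1}Q_{12})^{-1/2}\end{bmatrix}$, and $Z_1\sim N(0,\sigma^2I_{k_1})$, $Z_2\sim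 N(0,\sigma^2I_{k_2})$ are independent. This limit distribution has Lebesgue density $f_{\infty,\gamma}$ given, for $t=(t_1',t_2')'$, by: with $D_{\infty2}=(Q_{22}-Q_{21}Q_{11}^{-1}Q_{12})^{-1/2}$, $w=D_{\infty2}^{-1}(t_2+\gamma)$, $G=g(\|w\|)$, $$f_{\infty,\gamma}(t)=(2\pi\sigma^2)^{-k/2}[\det Q]^{1/2}\exp\Big(-\tfrac1{2\sigma^2}\|Q_{11}^{1/2}t_1+Q_{11}^{-1/2}Q_{12}t_2\|^2\Big)\big[1+\exp(-\alpha\sigma^{-2}G^2+2\alpha k_2)\big]^{k_2}$$ $$\times\Big\{1+2\alpha\sigma^{-2}G^2\big[1+\exp(\alpha\sigma^{-2}G^2-2\alpha k_2)\big]^{-1}\Big\}^{-1}\exp\Big(-\tfrac1{2\sigma^2}\big\|G\,w/\|w\|-D_{\infty2}^{-1}\gamma\big\|^2\Big),$$ with the convention $G\,w/\|w\|=0$ when $w=0$.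
   Context: Setup: for each sample size $n$, $Y=X\beta+u$, where $Y$ is $n\times1$, $X$ is a non-stochastic $n\times k$ matrix of full column rank $k$ (so $n\ge k$), $k>1$, and $u\sim N(0,\sigma^2I_n)$ with $0<\sigma^2<\infty$ known. $\mathbb{P}_{n,\beta,\sigma}$ denotes the distribution of $Y$. Partition $X=[X_1:X_2]$ and $\beta=(\beta_1',\beta_2')'$ commensurably, with $X_i$ having $k_i\ge1$ columns. $\hat\beta(R)=\big(((X_1'X_1)^{-1}X_1'Y)',0_{1\times k_2}\big)'$, $\hat\beta(U)=(X'X)^{-1}X'Y$. For $\alpha>0$, $\tilde\beta=\hat\lambda\hat\beta(R)+(1-\hat\lambda)\hat\beta(U)$ with $\hat\lambda=\big[1+\exp(-2\alpha k_2)\exp(\alpha\|X\hat\beta(R)-X\hat\beta(U)\|^2/\sigma^2)\big]^{-1}$. $A^{1/2}$ is the symmetric positive definite root. Function $g$: with $a=\exp(2\alpha k_2)$, $b=\sigma^2/\alpha$, $h(\xi)=[1+a\exp(-\xi^2/b)]^{-1}\xi$ on $[0,\infty)$ is a continuous strictly increasing bijection of $[0,\infty)$, and $g$ is its inverse. *)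

theory Defs
  imports "HOL-Probability.Probability"
begin

definition vjoin :: "real^'a::finite \<Rightarrow> real^'b::finite \<Rightarrow> real^('a + 'b)" where
  "vjoin a b = (\<chi> j. case j of Inl i \<Rightarrow> a $ i | Inr i \<Rightarrow> b $ i)"

definition vfst :: "real^('a::finite + 'b::finite) \<Rightarrow> real^'a" where
  "vfst v = (\<chi> i. v $ Inl i)"

definition vsnd :: "real^('a::finite + 'b::finite) \<Rightarrow> real^'b" where
  "vsnd v = (\<chi> i. v $ Inr i)"

definition blk11 :: "real^('a::finite + 'b::finite)^('a + 'b) \<Rightarrow> real^'a^'a" where
  "blk11 M = (\<chi> i j. M $ Inl i $ Inl j)"
definition blk12 :: "real^('a::finite + 'b::finite)^('a + 'b) \<Rightarrow> real^'b^'a" where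
  "blk12 M = (\<chi> i j. M $ Inl i $ Inr j)"
definition blk21 :: "real^('a::finite + 'b::finite)^('a + 'b) \<Rightarrow> real^'a^'b" where
  "blk21 M = (\<chi> i j. M $ Inr i $ Inl j)"
definition blk22 :: "real^('a::finite + 'b::finite)^('a + 'b) \<Rightarrow> real^'b^'b" where
  "blk22 M = (\<chi> i j. M $ Inr i $ Inr j)"

definition pos_def :: "real^'n::finite^'n \<Rightarrow> bool" where
  "pos_def A \<longleftrightarrow> transpose A = A \<and> (\<forall>x. x \<noteq> 0 \<longrightarrow> 0 < x \<bullet> (A *v x))"

definition msqrt :: "real^'n::finite^'n \<Rightarrow> real^'n^'n" where
  "msqrt A = (THE B. pos_def B \<and> B ** B = A)"

definition minvsqrt :: "real^'n::finite^'n \<Rightarrow> real^'n^'n" where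
  "minvsqrt A = matrix_inv (msqrt A)"

(* Design: X n i j, row i < n, column j; Gram matrix X'X *)
definition gram :: "(nat \<Rightarrow> nat \<Rightarrow> 'k::finite \<Rightarrow> real) \<Rightarrow> nat \<Rightarrow> real^'k^'k" where
  "gram X n = (\<chi> j l. \<Sum>i<n. X n i j * X n i l)"

definition full_col_rank :: "(nat \<Rightarrow> nat \<Rightarrow> 'k::finite \<Rightarrow> real) \<Rightarrow> nat \<Rightarrow> bool" where
  "full_col_rank X n \<longleftrightarrow> (\<forall>b::real^'k. (\<forall>i<n. (\<Sum>j\<in>UNIV. X n i j * b $ j) = 0) \<longrightarrow> b = 0)"

(* distribution P_{n,beta,sigma} of Y = X beta + u, u ~ N(0, sigma^2 I_n); Y as a function on {..<n} *)
definition PY :: "(nat \<Rightarrow> nat \<Rightarrow> 'k::finite \<Rightarrow> real) \<Rightarrow> nat \<Rightarrow> real^'k \<Rightarrow> real \<Rightarrow> (nat \<Rightarrow> real) measure" where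
  "PY X n \<beta> \<sigma> = PiM {..<n} (\<lambda>i. density lborel (\<lambda>y. ennreal (normal_density (\<Sum>j\<in>UNIV. X n i j * \<beta> $ j) \<sigma> y)))"

definition betaU :: "(nat \<Rightarrow> nat \<Rightarrow> 'k::finite \<Rightarrow> real) \<Rightarrow> nat \<Rightarrow> (nat \<Rightarrow> real) \<Rightarrow> real^'k" where
  "betaU X n Y = matrix_inv (gram X n) *v (\<chi> j. \<Sum>i<n. X n i j * Y i)"

definition betaR :: "(nat \<Rightarrow> nat \<Rightarrow> ('a::finite + 'b::finite) \<Rightarrow> real) \<Rightarrow> nat \<Rightarrow> (nat \<Rightarrow> real) \<Rightarrow> real^('a + 'b)" where
  "betaR X n Y = vjoin (matrix_inv (blk11 (gram X n)) *v (\<chi> j. \<Sum>i<n. X n i (Inl j) * Y i)) 0"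

definition betaTilde :: "real \<Rightarrow> real \<Rightarrow> (nat \<Rightarrow> nat \<Rightarrow> ('a::finite + 'b::finite) \<Rightarrow> real) \<Rightarrow> nat \<Rightarrow> (nat \<Rightarrow> real) \<Rightarrow> real^('a + 'b)" where
  "betaTilde \<alpha> \<sigma> X n Y =
    (let bR = betaR X n Y; bU = betaU X n Y;
         d2 = (\<Sum>i<n. (\<Sum>j\<in>UNIV. X n i j * (bR $ j - bU $ j))\<^sup>2);
         lam = 1 / (1 + exp (-2 * \<alpha> * real CARD('b)) * exp (\<alpha> * d2 / \<sigma>\<^sup>2))
     in lam *\<^sub>R bR + (1 - lam) *\<^sub>R bU)"

definition hfun :: "real \<Rightarrow> real \<Rightarrow> nat \<Rightarrow> real \<Rightarrow> real" where
  "hfun \<alpha> \<sigma> k2 \<xi> = \<xi> / (1 + exp (2 * \<alpha> * real k2) * exp (-\<xi>\<^sup>2 / (\<sigma>\<^sup>2 / \<alpha>)))"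

definition gfun :: "real \<Rightarrow> real \<Rightarrow> nat \<Rightarrow> real \<Rightarrow> real" where
  "gfun \<alpha> \<sigma> k2 \<xi> = (THE x. 0 \<le> x \<and> hfun \<alpha> \<sigma> k2 x = \<xi>)"

definition gaussI :: "real \<Rightarrow> (real^'m::finite) measure" where
  "gaussI \<sigma> = density lborel (\<lambda>z. ennreal (\<Prod>i\<in>UNIV. normal_density 0 \<sigma> (z $ i)))"

definition mvnormal :: "real^'m::finite^'m \<Rightarrow> (real^'m) measure" where
  "mvnormal S = density lborel (\<lambda>x. ennreal ((2 * pi) powr (- real CARD('m) / 2) * det S powr (-1/2)
                   * exp (- (x \<bullet> (matrix_inv S *v x)) / 2)))"

definition weak_conv :: "(nat \<Rightarrow> 'a::metric_space measure) \<Rightarrow> 'a measure \<Rightarrow> bool" where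
  "weak_conv M L \<longleftrightarrow> (\<forall>f :: 'a \<Rightarrow> real. continuous_on UNIV f \<and> bounded (range f) \<longrightarrow>
      (\<lambda>n. integral\<^sup>L (M n) f) \<longlonglongrightarrow> integral\<^sup>L L f)"

definition limit_law :: "real \<Rightarrow> real \<Rightarrow> real^('a::finite + 'b::finite)^('a + 'b) \<Rightarrow> real^'b \<Rightarrow> (real^('a + 'b)) measure" where
  "limit_law \<alpha> \<sigma> Q \<gamma> =
    (let Q11i = matrix_inv (blk11 Q); S = blk22 Q - blk21 Q ** Q11i ** blk12 Q;
         B = (\<lambda>v. vjoin (Q11i *v (blk12 Q *v v)) (- v));
         C = (\<lambda>z1. vjoin (minvsqrt (blk11 Q) *v z1) (0::real^'b));
         D = (\<lambda>z2. vjoin (- (Q11i *v (blk12 Q *v (minvsqrt S *v z2)))) (minvsqrt S *v z2))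
     in distr (gaussI \<sigma>) borel
        (\<lambda>z. B \<gamma> + C (vfst z)
             + (1 / (1 + exp (2 * \<alpha> * real CARD('b))
                   * exp (- \<alpha> * (norm (vsnd z + msqrt S *v \<gamma>))\<^sup>2 / \<sigma>\<^sup>2))) *\<^sub>R (D (vsnd z) - B \<gamma>)))"

definition f_inf :: "real \<Rightarrow> real \<Rightarrow> real^('a::finite + 'b::finite)^('a + 'b) \<Rightarrow> real^'b \<Rightarrow> real^('a + 'b) \<Rightarrow> real" where
  "f_inf \<alpha> \<sigma> Q \<gamma> t =
    (let k = real CARD('a + 'b); k2 = real CARD('b);
         Q11 = blk11 Q; S = blk22 Q - blk21 Q ** matrix_inv Q11 ** blk12 Q;
         D2 = minvsqrt S; D2i = matrix_inv D2;
         t1 = vfst t; t2 = vsnd t;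
         w = D2i *v (t2 + \<gamma>); G = gfun \<alpha> \<sigma> CARD('b) (norm w);
         Gw = (if w = 0 then 0 else (G / norm w) *\<^sub>R w)
     in (2 * pi * \<sigma>\<^sup>2) powr (- k / 2) * sqrt (det Q)
        * exp (- (norm (msqrt Q11 *v t1 + minvsqrt Q11 *v (blk12 Q *v t2)))\<^sup>2 / (2 * \<sigma>\<^sup>2))
        * (1 + exp (- \<alpha> * G\<^sup>2 / \<sigma>\<^sup>2 + 2 * \<alpha> * k2)) powr k2
        * inverse (1 + 2 * \<alpha> * G\<^sup>2 / \<sigma>\<^sup>2 * inverse (1 + exp (\<alpha> * G\<^sup>2 / \<sigma>\<^sup>2 - 2 * \<alpha> * k2)))
        * exp (- (norm (Gw - D2i *v \<gamma>))\<^sup>2 / (2 * \<sigma>\<^sup>2)))"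

end

theory Submission
  imports Defs "HOL-Real_Asymp.Real_Asymp"
begin

text \<open>Write \<open>V = \<surd>n (betaU - \<beta>)\<close>, \<open>g = \<surd>n \<beta>\<^sub>2\<close> and \<open>A = X'X/n\<close>. Both estimators are functions of \<open>betaU\<close>, and
  \<open>\<surd>n (betaTilde - \<beta>) = V + \<lambda> (regr A x, - x)\<close> with \<open>x = V\<^sub>2 + g\<close>, where the weight \<open>\<lambda>\<close> depends only on the
  quadratic form \<open>q\<close> of the Schur complement of \<open>A\<close> at \<open>x\<close>. The law of \<open>V\<close> is \<open>N(0, \<sigma>\<^sup>2 A\<^sup>-\<^sup>1)\<close>, so expectations are
  Lebesgue integrals against a density that converges, with a Gaussian dominating function, to that of
  \<open>N(0, \<sigma>\<^sup>2 Q\<^sup>-\<^sup>1)\<close>; dominated convergence then only needs the pointwise limit of the map. If \<open>g \<rightarrow> \<gamma>\<close> that is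
  continuity. If \<open>|g| \<rightarrow> \<infinity>\<close>, the correction is at most \<open>\<surd>(q/c)\<close> divided by a multiple of \<open>exp (\<alpha> q/\<sigma>\<^sup>2)\<close>, and \<open>q \<rightarrow> \<infinity>\<close>.
  For the density, the limiting map is, up to affine bijections, the radial map \<open>w \<mapsto> h(|w|) w/|w|\<close>, whose Jacobian
  is the determinant of a rank-one update of a multiple of the identity.\<close>

text \<open>The law of \<open>V\<close> and the map applied to it both vary with \<open>n\<close>;
  working with densities lets a single dominated convergence argument handle both. The obstacle is
  to obtain the density: \<open>PY\<close> is a product of \<open>n\<close> scalar normals, whereas
  \<open>V\<close> lives in a fixed finite-dimensional space. The weighted sum of errors is
  therefore built one observation at a time, and after each observation the surplus Gaussian
  coordinate is rotated into a kernel direction and discarded, which leaves a square matrix applied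
  to a standard Gaussian vector. That matrix can be singular, so densities enter only once the rank
  condition is available. The Schur complement appears because \<open>(regr A x, - x)\<close> is the
  point at which one of the two squares of the completed quadratic form vanishes. The same
  completion separates the blocks: in whitened coordinates averaging moves only the second block,
  and only radially. In the Jacobian the multiple of the identity produces the power
  \<open>k2\<close> in \<open>f_inf\<close>, and the rank-one update in the radial direction
  produces the single factor containing
  \<open>2 * \<alpha> * G\<^sup>2 / \<sigma>\<^sup>2\<close>.\<close>

section \<open>Change of variables for densities\<close>

text \<open>The change of variables theorem of the library asks for a well-ordered index type; this copy of a
  finite type provides one, and its results are transported back along \<open>Rep_wcopy\<close>.\<close>

typedef 'a wcopy = "UNIV :: 'a::finite set" by simp

lemma bij_Rep_wcopy: "bij Rep_wcopy"
  by (metis bijI' Rep_wcopy_inject Abs_wcopy_inverse UNIV_I)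

instance wcopy :: (finite) finite
proof
  have "inj (Rep_wcopy :: 'a wcopy \<Rightarrow> 'a)"
    using bij_Rep_wcopy by (rule bij_is_inj)
  then show "finite (UNIV :: 'a wcopy set)"
    by (rule inj_on_finite) auto
qed

instantiation wcopy :: (finite) wellorder
begin

definition less_eq_wcopy :: "'a wcopy \<Rightarrow> 'a wcopy \<Rightarrow> bool" where
  "less_eq_wcopy x y \<longleftrightarrow> to_nat (Rep_wcopy x) \<le> to_nat (Rep_wcopy y)"
definition less_wcopy :: "'a wcopy \<Rightarrow> 'a wcopy \<Rightarrow> bool" where
  "less_wcopy x y \<longleftrightarrow> to_nat (Rep_wcopy x) < to_nat (Rep_wcopy y)"

instance
proof
  fix P :: "'a wcopy \<Rightarrow> bool" and a
  assume *: "\<And>x. (\<And>y. y < x \<Longrightarrow> P y) \<Longrightarrow> P x"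
  show "P a"
    by (induction "to_nat (Rep_wcopy a)" arbitrary: a rule: less_induct)
       (metis * less_wcopy_def)
qed (auto simp: less_eq_wcopy_def less_wcopy_def Rep_wcopy_inject)

end

lemma emeasure_lborel_box_cart:
  fixes l u :: "real^'n"
  assumes "\<And>i. l $ i \<le> u $ i"
  shows "emeasure lborel (box l u) = ennreal (\<Prod>i\<in>UNIV. u $ i - l $ i)"
proof -
  have "(\<Prod>b\<in>Basis. (u - l) \<bullet> b) = (\<Prod>i\<in>UNIV. u $ i - l $ i)"
  proof (rule prod.reindex_bij_witness[of _ "\<lambda>i. axis i 1" "\<lambda>b. THE i. b = axis i 1"])
    fix b :: "real^'n" assume "b \<in> Basis"
    then obtain i where i: "b = axis i 1" by (auto simp: Basis_vec_def)
    then show "axis (THE i. b = axis i 1) 1 = b" "u $ (THE i. b = axis i 1) - l $ (THE i. b = axis i 1) = (u - l) \<bullet> b"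
      by (auto simp: axis_eq_axis inner_axis)
  qed (auto simp: axis_eq_axis Basis_vec_def)
  moreover have "l \<bullet> b \<le> u \<bullet> b" if "b \<in> Basis" for b
    using that assms by (auto simp: Basis_vec_def inner_axis)
  ultimately show ?thesis by simp
qed

lemma lborel_vec_eqI:
  fixes M :: "(real^'n) measure"
  assumes "\<And>l u. (\<And>i. l $ i \<le> u $ i) \<Longrightarrow> emeasure M (box l u) = ennreal (\<Prod>i\<in>UNIV. u $ i - l $ i)"
    and "sets M = sets borel"
  shows "lborel = M"
proof (rule lborel_eqI)
  fix l u :: "real^'n" assume "\<And>b. b \<in> Basis \<Longrightarrow> l \<bullet> b \<le> u \<bullet> b"
  then have *: "l $ i \<le> u $ i" for i
    using axis_in_Basis_iff[of i "1::real"] by (metis cart_eq_inner_axis real_inner_1_right Basis_real_def insertI1)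
  show "emeasure M (box l u) = (\<Prod>b\<in>Basis. (u - l) \<bullet> b)"
    using assms(1)[OF *] emeasure_lborel_box_cart[OF *] emeasure_lborel_box_eq[of l u] 
      \<open>\<And>b. b \<in> Basis \<Longrightarrow> l \<bullet> b \<le> u \<bullet> b\<close> by auto
qed fact

definition reindex :: "('m \<Rightarrow> 'n) \<Rightarrow> real^'n::finite \<Rightarrow> real^'m::finite" where
  "reindex f x = (\<chi> i. x $ f i)"

lemma reindex_nth [simp]: "reindex f x $ i = x $ f i"
  by (simp add: reindex_def)

lemma linear_reindex: "linear (reindex f)"
  by (auto intro!: linearI simp: vec_eq_iff)

lemma bounded_linear_reindex: "bounded_linear (reindex f)"
  using linear_reindex linear_conv_bounded_linear by blast

lemma continuous_reindex: "continuous_on A (reindex f)"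
  using bounded_linear_reindex linear_continuous_on by blast

lemma measurable_reindex [measurable]: "reindex f \<in> borel_measurable borel"
  by (simp add: borel_measurable_continuous_onI continuous_reindex)

lemma distr_lborel_reindex:
  assumes "bij f"
  shows "distr lborel borel (reindex f :: real^'n \<Rightarrow> real^'m) = lborel"
proof (rule lborel_vec_eqI[symmetric])
  fix l u :: "real^'m" assume le: "\<And>i. l $ i \<le> u $ i"
  let ?g = "inv f"
  have g: "f (?g i) = i" "?g (f j) = j" for i j
    using assms by (auto simp: bij_is_surj surj_f_inv_f bij_is_inj)
  have "reindex f -` box l u = box (reindex ?g l) (reindex ?g u)"
    by (auto simp: mem_box_cart) (metis g)+
  then have "emeasure (distr lborel borel (reindex f)) (box l u) = ennreal (\<Prod>i\<in>UNIV. u $ ?g i - l $ ?g i)"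
    using le by (simp add: emeasure_distr emeasure_lborel_box_cart)
  also have "(\<Prod>i\<in>UNIV. u $ ?g i - l $ ?g i) = (\<Prod>i\<in>UNIV. u $ i - l $ i)"
    using assms by (intro prod.reindex_bij_betw) (simp add: bij_betw_inv_into)
  finally show "emeasure (distr lborel borel (reindex f)) (box l u) = ennreal (\<Prod>i\<in>UNIV. u $ i - l $ i)" .
qed simp

text \<open>In the Leibniz expansion, transporting permutations along \<open>f\<close> is a
  sign-preserving bijection, and relabelling the factors matches the products.\<close>

lemma det_reindex:
  fixes A :: "real^'n^'n" and f :: "'m::finite \<Rightarrow> 'n::finite"
  assumes "bij f"
  shows "det (\<chi> i j. A $ f i $ f j) = det A"
proof -
  let ?m = "map_permutation UNIV f"
  have inj: "inj f" and [simp]: "range f = UNIV" using assms by (auto simp: bij_is_inj bij_is_surj)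
  have bij: "bij_betw ?m {p. p permutes UNIV} {p. p permutes UNIV}"
    by (rule bij_betw_byWitness[where f' = "map_permutation UNIV (inv f)"])
       (use assms in \<open>auto simp: map_permutation_compose_inv map_permutation_permutes bij_betw_inv_into
          bij_is_inj bij_is_surj surj_f_inv_f map_permutation_compose_inv[of f UNIV UNIV]
          map_permutation_compose_inv[of "inv f" UNIV UNIV]\<close>)
  have "det A = (\<Sum>p | p permutes (UNIV::'m set). of_int (sign (?m p)) * (\<Prod>i\<in>UNIV. A $ i $ ?m p i))"
    unfolding det_def by (rule sum.reindex_bij_betw[OF bij, symmetric])
  also have "\<dots> = (\<Sum>p | p permutes (UNIV::'m set). of_int (sign p) * (\<Prod>i\<in>UNIV. A $ f i $ f (p i)))"
  proof (rule sum.cong)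
    fix p :: "'m \<Rightarrow> 'm" assume "p \<in> {p. p permutes UNIV}"
    then have p: "p permutes UNIV" by simp
    have "sign (?m p) = sign p" using p inj by (intro sign_map_permutation) auto
    moreover have "(\<Prod>i\<in>UNIV. A $ i $ ?m p i) = (\<Prod>i\<in>UNIV. A $ f i $ ?m p (f i))"
      by (rule prod.reindex_bij_betw[OF assms, symmetric])
    moreover have "?m p (f i) = f (p i)" for i
      using p inj by (simp add: map_permutation_apply)
    ultimately show "of_int (sign (?m p)) * (\<Prod>i\<in>UNIV. A $ i $ ?m p i) =
       (of_int (sign p) * (\<Prod>i\<in>UNIV. A $ f i $ f (p i)) :: real)" by simp
  qed simp
  finally show ?thesis by (simp add: det_def)
qed

text \<open>Both measures are compared on a Borel set \<open>A\<close> by applying the integral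
  formula to \<open>q\<close> cut off to \<open>A\<close>. The formula transfers absolute
  integrability as well, so integrability of \<open>p\<close> is enough to start.\<close>

lemma distr_density_change_of_variables_wellorder:
  fixes F :: "real^'n::{finite,wellorder} \<Rightarrow> real^'n::_"
  assumes der: "\<And>x. (F has_derivative F' x) (at x)" and bij: "bij F"
    and [measurable]: "p \<in> borel_measurable borel" "q \<in> borel_measurable borel"
    and nonneg: "\<And>x. 0 \<le> p x" "\<And>x. 0 \<le> q x" and int: "integrable lborel p"
    and eq: "\<And>x. \<bar>det (matrix (F' x))\<bar> * q (F x) = p x"
  shows "distr (density lborel (\<lambda>x. ennreal (p x))) borel F = density lborel (\<lambda>x. ennreal (q x))"
proof (rule measure_eqI)
  have "continuous_on UNIV F"
    using der has_derivative_continuous_on[of UNIV F F'] by auto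
  then have [measurable]: "F \<in> borel_measurable borel"
    by (simp add: borel_measurable_continuous_onI)
  fix A assume "A \<in> sets (distr (density lborel p) borel F)"
  then have [measurable]: "A \<in> sets borel" by simp
  let ?f = "\<lambda>x. indicat_real A x * q x" and ?g = "\<lambda>x. indicat_real (F -` A) x * p x"
  have [measurable]: "F -` A \<in> sets borel"
    using measurable_sets[of F borel borel A] by simp
  have g: "integrable lborel ?g"
    using integrable_mult_indicator[of "F -` A" lborel p] int by simp
  \<comment> \<open>The change of variables formula concerns vector-valued integrands, hence the
    detour through \<open>real^1\<close>.\<close>
  have g': "\<bar>det (matrix (F' x))\<bar> *\<^sub>R vec (?f (F x)) = (vec (?g x) :: real^1)" for x
    using eq[of x] by (auto simp: indicator_def vec_eq_iff)
  have "?g absolutely_integrable_on UNIV"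
    using g by (simp add: set_integrable_def integrable_completion)
  then have "?f absolutely_integrable_on UNIV \<and> integral UNIV ?f = integral UNIV ?g"
    using has_absolute_integral_change_of_variables[of UNIV F F' "\<lambda>x. vec (?f x) :: real^1" "vec (integral UNIV ?g)"]
      der bij g'
    by (simp add: bij_is_inj bij_is_surj absolutely_integrable_on_1_iff integral_on_1_eq g')
  then have f: "integrable lborel ?f" "integral UNIV ?f = integral UNIV ?g"
    by (simp_all add: set_integrable_def integrable_completion)
  have "emeasure (distr (density lborel p) borel F) A = (\<integral>\<^sup>+x. ennreal (?g x) \<partial>lborel)"
    by (auto simp: emeasure_distr emeasure_density nonneg indicator_def intro!: nn_integral_cong)
  also have "\<dots> = ennreal (integral\<^sup>L lborel ?g)"
    using g nonneg by (intro nn_integral_eq_integral) auto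
  also have "\<dots> = ennreal (integral\<^sup>L lborel ?f)"
    using f g by (simp add: integral_lborel)
  also have "\<dots> = (\<integral>\<^sup>+x. ennreal (?f x) \<partial>lborel)"
    using f nonneg by (intro nn_integral_eq_integral[symmetric]) auto
  also have "\<dots> = emeasure (density lborel q) A"
    by (auto simp: emeasure_density nonneg indicator_def intro!: nn_integral_cong)
  finally show "emeasure (distr (density lborel p) borel F) A = emeasure (density lborel q) A" .
qed simp


lemma density_reindex:
  fixes h :: "real^'n \<Rightarrow> ennreal" and f :: "'m::finite \<Rightarrow> 'n::finite"
  assumes f: "bij f" and [measurable]: "h \<in> borel_measurable borel"
  shows "distr (density lborel h) borel (reindex f) = density lborel (\<lambda>x. h (reindex (inv f) x))"
proof -
  have *: "reindex (inv f) (reindex f x) = x" for x :: "real^'n"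
    using f by (simp add: vec_eq_iff bij_is_surj surj_f_inv_f)
  have "density lborel (\<lambda>x. h (reindex (inv f) x)) =
      density (distr lborel borel (reindex f)) (\<lambda>x. h (reindex (inv f) x))"
    by (simp add: distr_lborel_reindex[OF f])
  also have "\<dots> = distr (density lborel (\<lambda>x. h (reindex (inv f) (reindex f x)))) borel (reindex f)"
    by (rule density_distr) auto
  finally show ?thesis by (simp add: *)
qed

text \<open>Measurability of \<open>q\<close> is a conclusion because of the intended use for
  \<open>f_inf\<close>, whose ingredient \<open>gfun\<close> is a definite description. The Jacobian
  is passed as an explicit function \<open>J\<close> so that its measurability can be read off a
  formula. Conjugation with \<open>reindex\<close> leaves the determinant unchanged.\<close>

lemma distr_density_change_of_variables:
  fixes F :: "real^'n::finite \<Rightarrow> real^'n"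
  assumes der: "\<And>x. (F has_derivative F' x) (at x)" and bij: "bij F"
    and p [measurable]: "p \<in> borel_measurable borel" and J [measurable]: "J \<in> borel_measurable borel"
    and nonneg: "\<And>x. 0 \<le> p x" and int: "integrable lborel p"
    and det: "\<And>x. \<bar>det (matrix (F' x))\<bar> = J x" and J_pos: "\<And>x. 0 < J x"
    and eq: "\<And>x. J x * q (F x) = p x"
  shows "q \<in> borel_measurable borel"
    and "distr (density lborel (\<lambda>x. ennreal (p x))) borel F = density lborel (\<lambda>x. ennreal (q x))"
proof -
  have cont: "continuous_on UNIV F"
    using der has_derivative_continuous_on[of UNIV F F'] by auto
  then have [measurable]: "F \<in> borel_measurable borel"
    by (simp add: borel_measurable_continuous_onI)
  (* The inverse is continuous by invariance of domain, hence q is Borel without assuming it. *)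
  obtain G where "homeomorphism UNIV (F ` UNIV) F G"
    using invariance_of_domain_homeomorphism[OF open_UNIV cont] bij by (auto simp: bij_def)
  then have "continuous_on UNIV G" and FG: "\<And>y. F (G y) = y"
    using bij_is_surj[OF bij] homeomorphism_apply2 homeomorphism_cont2 by fastforce+
  then have [measurable]: "G \<in> borel_measurable borel"
    by (simp add: borel_measurable_continuous_onI)
  have "q y = p (G y) / J (G y)" for y
    using eq[of "G y"] J_pos[of "G y"] FG[of y] by (simp add: field_simps)
  then have "q = (\<lambda>y. p (G y) / J (G y))" by auto
  then show q [measurable]: "q \<in> borel_measurable borel" by simp
  have q_nonneg: "0 \<le> q y" for y
    using eq[of "G y"] J_pos[of "G y"] FG[of y] nonneg[of "G y"] by (metis zero_le_mult_iff not_less)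
  let ?r = "Rep_wcopy :: 'n wcopy \<Rightarrow> 'n"
  let ?i = "reindex ?r :: real^'n \<Rightarrow> real^'n wcopy" and ?j = "reindex (inv ?r) :: real^'n wcopy \<Rightarrow> real^'n"
  have r: "bij ?r" by (rule bij_Rep_wcopy)
  have ij: "?i (?j x) = x" "?j (?i y) = y" for x y
    using r by (simp_all add: vec_eq_iff bij_is_surj surj_f_inv_f bij_is_inj)
  let ?F = "\<lambda>x. ?i (F (?j x))"
  have inv_r: "inv (inv ?r) = ?r" by (rule inv_inv_eq[OF r])
  have "distr (density lborel (\<lambda>x. ennreal (p (?j x)))) borel ?F = density lborel (\<lambda>x. ennreal (q (?j x)))"
  proof (rule distr_density_change_of_variables_wellorder)
    fix x
    show "(?F has_derivative (\<lambda>h. ?i (F' (?j x) (?j h)))) (at x)"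
      by (rule bounded_linear.has_derivative[OF bounded_linear_reindex]
          has_derivative_compose[of ?j ?j, OF bounded_linear_imp_has_derivative[OF bounded_linear_reindex] der])+
    have j: "?j (axis b 1) = axis (?r b) 1" for b
      using r unfolding reindex_def by (auto simp: vec_eq_iff axis_def bij_is_surj surj_f_inv_f bij_is_inj)
    have "matrix (\<lambda>h. ?i (F' (?j x) (?j h))) = (\<chi> a b. matrix (F' (?j x)) $ ?r a $ ?r b)"
      by (simp add: matrix_def vec_eq_iff j)
    then have "\<bar>det (matrix (\<lambda>h. ?i (F' (?j x) (?j h))))\<bar> = J (?j x)"
      by (simp add: det_reindex[OF r] det)
    then show "\<bar>det (matrix (\<lambda>h. ?i (F' (?j x) (?j h))))\<bar> * q (?j (?F x)) = p (?j x)"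
      by (simp add: ij eq)
  next
    show "bij ?F"
      using bij by (intro o_bij[of "\<lambda>x. ?i (inv F (?j x))"])
        (auto simp: fun_eq_iff ij bij_is_surj surj_f_inv_f bij_is_inj)
    have "integrable (distr lborel borel ?i) (\<lambda>x. p (?j x))"
      by (subst integrable_distr_eq) (auto simp: ij int)
    then show "integrable lborel (\<lambda>x. p (?j x))"
      by (simp add: distr_lborel_reindex[OF r])
  qed (auto simp: nonneg q_nonneg)
  then have "distr (distr (density lborel (\<lambda>x. ennreal (p (?j x)))) borel ?F) borel ?j =
      distr (density lborel (\<lambda>x. ennreal (q (?j x)))) borel ?j" by simp
  also have "\<dots> = density lborel (\<lambda>x. ennreal (q x))"
    using density_reindex[OF bij_imp_bij_inv[OF r], of "\<lambda>x. ennreal (q (?j x))"]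
    by (simp add: inv_r ij)
  also have "density lborel (\<lambda>x. ennreal (p (?j x))) = distr (density lborel (\<lambda>x. ennreal (p x))) borel ?i"
    using density_reindex[OF r, of "\<lambda>x. ennreal (p x)"] by simp
  finally show "distr (density lborel (\<lambda>x. ennreal (p x))) borel F = density lborel (\<lambda>x. ennreal (q x))"
    by (simp add: distr_distr o_def ij)
qed

section \<open>Symmetric matrices and their square roots\<close>

text \<open>First-order condition at a minimum, in a form that avoids differentiation.\<close>

lemma quadratic_nonneg_linear_coeff_zero:
  fixes b c :: real
  assumes "\<And>t. 0 \<le> 2 * t * b + t\<^sup>2 * c"
  shows "b = 0"
proof (rule ccontr)
  assume "b \<noteq> 0"
  \<comment> \<open>\<open>d\<close> is positive and exceeds \<open>c\<close>, so at
    \<open>t = - b / d\<close> the expression equals \<open>(b / d)\<^sup>2\<close> times the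
    negative number \<open>c - 2 * d\<close>.\<close>
  define d where "d = \<bar>c\<bar> + 1"
  have "d > 0" "c < d" by (auto simp: d_def)
  have "0 \<le> 2 * (- b / d) * b + (- b / d)\<^sup>2 * c" by (rule assms)
  also have "\<dots> = (b / d)\<^sup>2 * (c - 2 * d)"
    using \<open>d > 0\<close> by (simp add: field_simps power2_eq_square)
  also have "\<dots> < 0"
    using \<open>b \<noteq> 0\<close> \<open>d > 0\<close> \<open>c < d\<close> by (intro mult_pos_neg) auto
  finally show False by simp
qed

text \<open>Rayleigh quotient: \<open>e\<close> maximises \<open>x \<bullet> f x\<close> on the unit
  sphere of \<open>U\<close>. The form of \<open>g = l - f\<close> is nonnegative on
  \<open>U\<close> and vanishes at \<open>e\<close>; perturbing \<open>e\<close> in directions of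
  \<open>U\<close> shows that \<open>g e\<close> is orthogonal to \<open>U\<close>, and it lies in
  \<open>U\<close>.\<close>

lemma selfadjoint_max_eigenvector:
  fixes f :: "'a::euclidean_space \<Rightarrow> 'a"
  assumes f: "linear f" and sa: "\<And>x y. f x \<bullet> y = x \<bullet> f y"
    and U: "subspace U" "f ` U \<subseteq> U" "U \<noteq> {0}"
  obtains e l where "e \<in> U" "norm e = 1" "f e = l *\<^sub>R e"
proof -
  interpret f: linear f by (rule f)
  let ?K = "U \<inter> sphere 0 1"
  obtain u where "u \<in> U" "u \<noteq> 0" using U subspace_0 by blast
  then have "(1 / norm u) *\<^sub>R u \<in> ?K" using U by (auto simp: subspace_scale)
  then have "?K \<noteq> {}" by blast
  moreover have "compact ?K"
    using U by (simp add: closed_subspace closed_Int_compact)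
  moreover have "continuous_on ?K (\<lambda>x. x \<bullet> f x)"
    using f by (intro continuous_intros linear_continuous_on) (simp add: linear_conv_bounded_linear)
  ultimately obtain e where e: "e \<in> ?K" and max: "\<And>x. x \<in> ?K \<Longrightarrow> x \<bullet> f x \<le> e \<bullet> f e"
    using continuous_attains_sup[of ?K] by blast
  define l where "l = e \<bullet> f e"
  have ee: "e \<bullet> e = 1" using e by (simp add: dot_square_norm)
  define g where "g x = l *\<^sub>R x - f x" for x
  have psd: "0 \<le> x \<bullet> g x" if "x \<in> U" for x
  proof (cases "x = 0")
    case False
    have "((1 / norm x) *\<^sub>R x) \<bullet> f ((1 / norm x) *\<^sub>R x) \<le> l"
      unfolding l_def by (rule max) (use that False U in \<open>auto simp: subspace_scale\<close>)
    then have "x \<bullet> f x \<le> l * (norm x)\<^sup>2"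
      using False by (simp add: f.scaleR field_simps power2_eq_square)
    then show ?thesis by (simp add: g_def inner_diff_right dot_square_norm)
  qed (simp add: g_def)
  have "y \<bullet> g e = 0" if "y \<in> U" for y
  proof (rule quadratic_nonneg_linear_coeff_zero[where c = "y \<bullet> g y"])
    fix t :: real
    have "e + t *\<^sub>R y \<in> U" using e that U by (auto simp: subspace_add subspace_scale)
    from psd[OF this] have "0 \<le> (e + t *\<^sub>R y) \<bullet> g (e + t *\<^sub>R y)" .
    also have "\<dots> = 2 * t * (y \<bullet> g e) + t\<^sup>2 * (y \<bullet> g y)"
      using ee sa[of e y] by (simp add: g_def f.add f.scaleR inner_simps l_def[symmetric] algebra_simps
          power2_eq_square inner_commute)
    finally show "0 \<le> 2 * t * (y \<bullet> g e) + t\<^sup>2 * (y \<bullet> g y)" .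
  qed
  moreover have "g e \<in> U" using e U by (auto simp: g_def subspace_diff subspace_scale)
  ultimately have "g e = 0" by (metis inner_eq_zero_iff)
  then have "f e = l *\<^sub>R e" by (simp add: g_def)
  with e show ?thesis by (intro that[of e l]) auto
qed

text \<open>Deflation: by self-adjointness the part of \<open>U\<close> orthogonal to an eigenvector
  is again invariant, and its dimension is smaller.\<close>

lemma selfadjoint_eigenbasis_subspace:
  fixes f :: "'a::euclidean_space \<Rightarrow> 'a"
  assumes f: "linear f" and sa: "\<And>x y. f x \<bullet> y = x \<bullet> f y"
  shows "subspace U \<Longrightarrow> f ` U \<subseteq> U \<Longrightarrow>
    \<exists>E\<subseteq>U. finite E \<and> pairwise orthogonal E \<and> (\<forall>e\<in>E. norm e = 1 \<and> (\<exists>l. f e = l *\<^sub>R e)) \<and> span E = U"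
proof (induction "dim U" arbitrary: U rule: less_induct)
  case less
  show ?case
  proof (cases "U = {0}")
    case True
    then show ?thesis by (intro exI[of _ "{}"]) auto
  next
    case False
    then obtain e l where e: "e \<in> U" "norm e = 1" "f e = l *\<^sub>R e"
      using selfadjoint_max_eigenvector[OF f sa less.prems] by blast
    define W where "W = {x \<in> U. x \<bullet> e = 0}"
    have W: "subspace W"
      using less.prems unfolding W_def subspace_def by (auto simp: inner_simps)
    have "W \<subseteq> U" by (auto simp: W_def)
    have "e \<notin> W" using e by (auto simp: W_def dot_square_norm)
    then have "W \<subset> U" using \<open>W \<subseteq> U\<close> e by blast
    then have "dim W < dim U"
      using W less.prems by (metis dim_psubset span_eq_iff)
    moreover have "f ` W \<subseteq> W"
      using less.prems(2) e sa[of _ e] by (auto simp: W_def)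
    ultimately obtain E where E: "E \<subseteq> W" "finite E" "pairwise orthogonal E"
      "\<forall>e\<in>E. norm e = 1 \<and> (\<exists>l. f e = l *\<^sub>R e)" "span E = W"
      using less.hyps[OF _ W] by blast
    have "span (insert e E) = U"
    proof
      show "span (insert e E) \<subseteq> U"
        using E \<open>W \<subseteq> U\<close> e less.prems by (intro span_minimal) auto
      show "U \<subseteq> span (insert e E)"
      proof
        fix x assume "x \<in> U"
        then have "x - (x \<bullet> e) *\<^sub>R e \<in> W"
          using e less.prems by (auto simp: W_def inner_simps dot_square_norm subspace_diff subspace_scale)
        then show "x \<in> span (insert e E)"
          using E by (auto simp: span_insert)
      qed
    qed
    moreover have "pairwise orthogonal (insert e E)"
      using E by (auto simp: pairwise_insert orthogonal_def W_def inner_commute)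
    ultimately show ?thesis
      using E e \<open>W \<subseteq> U\<close> by (intro exI[of _ "insert e E"]) auto
  qed
qed

lemma selfadjoint_eigenbasis:
  fixes f :: "'a::euclidean_space \<Rightarrow> 'a"
  assumes f: "linear f" and sa: "\<And>x y. f x \<bullet> y = x \<bullet> f y"
  obtains E l where "finite E" "\<And>e. e \<in> E \<Longrightarrow> norm e = 1" "\<And>e. e \<in> E \<Longrightarrow> f e = l e *\<^sub>R e"
    "\<And>d e. d \<in> E \<Longrightarrow> e \<in> E \<Longrightarrow> d \<bullet> e = (if d = e then 1 else 0)"
    "\<And>x. (\<Sum>e\<in>E. (x \<bullet> e) *\<^sub>R e) = x"
proof -
  obtain E where E: "finite E" "pairwise orthogonal E"
      "\<forall>e\<in>E. norm e = 1 \<and> (\<exists>l. f e = l *\<^sub>R e)" "span E = UNIV"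
    using selfadjoint_eigenbasis_subspace[OF f sa, of UNIV] by auto
  then obtain l where l: "\<forall>e\<in>E. f e = l e *\<^sub>R e" by metis
  have on: "d \<bullet> e = (if d = e then 1 else 0)" if "d \<in> E" "e \<in> E" for d e
    using that E by (auto simp: pairwise_def orthogonal_def dot_square_norm)
  have "(\<Sum>e\<in>E. (x \<bullet> e) *\<^sub>R e) = x" for x
  proof -
    \<comment> \<open>The residual is orthogonal to every element of \<open>E\<close>, hence to the
      whole span, which contains the residual itself.\<close>
    define y where "y = x - (\<Sum>e\<in>E. (x \<bullet> e) *\<^sub>R e)"
    have "orthogonal y d" if "d \<in> E" for d
    proof -
      have "(\<Sum>e\<in>E. (x \<bullet> e) * (e \<bullet> d)) = (\<Sum>e\<in>E. if e = d then x \<bullet> d else 0)"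
        using that on by (intro sum.cong) auto
      then show ?thesis
        using that E(1) by (simp add: y_def orthogonal_def inner_diff_left inner_sum_left)
    qed
    then have "orthogonal y y"
      using E by (intro orthogonal_to_span[of y E y]) auto
    then show ?thesis by (simp add: y_def orthogonal_def)
  qed
  with E l on show ?thesis by (intro that[of E l]) auto
qed

lemma pos_def_sym: "pos_def A \<Longrightarrow> (A *v x) \<bullet> y = x \<bullet> (A *v y)"
  unfolding pos_def_def by (metis dot_lmul_matrix inner_commute transpose_matrix_vector vector_transpose_matrix)

lemma symmetric_matrixI:
  fixes A :: "real^'n^'n"
  assumes "\<And>x y. (A *v x) \<bullet> y = x \<bullet> (A *v y)"
  shows "transpose A = A"
proof -
  have "A $ i $ j = A $ j $ i" for i j
    using assms[of "axis i 1" "axis j 1"]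
    by (simp add: matrix_vector_mul_component inner_axis inner_axis' row_def cart_eq_inner_axis[symmetric] column_def)
  then show ?thesis by (simp add: transpose_def vec_eq_iff)
qed

lemma pos_defI:
  assumes "\<And>x y. (A *v x) \<bullet> y = x \<bullet> (A *v y)" "\<And>x. x \<noteq> 0 \<Longrightarrow> 0 < x \<bullet> (A *v x)"
  shows "pos_def A"
  using assms symmetric_matrixI[of A] by (auto simp: pos_def_def)

lemma pos_def_pos: "pos_def A \<Longrightarrow> x \<noteq> 0 \<Longrightarrow> 0 < x \<bullet> (A *v x)"
  by (simp add: pos_def_def)

lemma pos_def_sqrt_exists:
  fixes A :: "real^'n^'n"
  assumes A: "pos_def A"
  shows "\<exists>B. pos_def B \<and> B ** B = A"
proof -
  obtain E l where E: "finite E" "\<And>e. e \<in> E \<Longrightarrow> norm e = 1" "\<And>e. e \<in> E \<Longrightarrow> A *v e = l e *\<^sub>R e"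
    "\<And>d e. d \<in> E \<Longrightarrow> e \<in> E \<Longrightarrow> d \<bullet> e = (if d = e then 1 else 0)"
    "\<And>x. (\<Sum>e\<in>E. (x \<bullet> e) *\<^sub>R e) = x"
    by (rule selfadjoint_eigenbasis[OF matrix_vector_mul_linear[of A] pos_def_sym[OF A]]) blast
  have l: "l e > 0" if "e \<in> E" for e
    using pos_def_pos[OF A, of e] E(2,3)[OF that] by (cases "e = 0") (auto simp: dot_square_norm)
  \<comment> \<open>Spectral calculus: \<open>g\<close> multiplies the eigenvector \<open>e\<close>
    by \<open>sqrt (l e)\<close>.\<close>
  define g where "g x = (\<Sum>e\<in>E. (sqrt (l e) * (x \<bullet> e)) *\<^sub>R e)" for x
  have "linear g"
    by (auto intro!: linearI simp: g_def inner_simps algebra_simps sum.distrib scaleR_sum_right)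
  define B where "B = matrix g"
  have B: "B *v x = g x" for x
    using \<open>linear g\<close> by (simp add: B_def)
  have ge: "g e = sqrt (l e) *\<^sub>R e" if "e \<in> E" for e
  proof -
    have "g e = (\<Sum>d\<in>E. if e = d then sqrt (l e) *\<^sub>R e else 0)"
      unfolding g_def using that E(4) by (intro sum.cong) auto
    then show ?thesis using that E(1) by simp
  qed
  have g: "g x \<bullet> y = (\<Sum>e\<in>E. sqrt (l e) * (x \<bullet> e) * (y \<bullet> e))" for x y
    unfolding g_def inner_sum_left by (intro sum.cong) (auto simp: inner_commute)
  have "pos_def B"
  proof (rule pos_defI)
    show "(B *v x) \<bullet> y = x \<bullet> (B *v y)" for x y
    proof -
      have "g x \<bullet> y = g y \<bullet> x" unfolding g by (intro sum.cong) auto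
      then show ?thesis by (simp only: B inner_commute[of x "g y"])
    qed
    fix x :: "real^'n" assume "x \<noteq> 0"
    have "\<exists>d\<in>E. x \<bullet> d \<noteq> 0"
    proof (rule ccontr)
      assume "\<not> ?thesis"
      then have "(\<Sum>e\<in>E. (x \<bullet> e) *\<^sub>R e) = 0" by (intro sum.neutral) auto
      with \<open>x \<noteq> 0\<close> show False by (simp add: E(5))
    qed
    then obtain d where d: "d \<in> E" "x \<bullet> d \<noteq> 0" by blast
    have "0 < (\<Sum>e\<in>E. sqrt (l e) * (x \<bullet> e) * (x \<bullet> e))"
    proof (rule sum_pos2[OF E(1) d(1)])
      show "0 < sqrt (l d) * (x \<bullet> d) * (x \<bullet> d)" using d(2) l[OF d(1)] by (simp add: mult.assoc zero_less_mult_iff[of "sqrt _"] flip: power2_eq_square)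
      show "0 \<le> sqrt (l e) * (x \<bullet> e) * (x \<bullet> e)" if "e \<in> E" for e
        using l[OF that] by (simp add: mult.assoc)
    qed
    then show "0 < x \<bullet> (B *v x)" by (simp only: B inner_commute[of x "g x"] g)
  qed
  moreover have "B ** B = A"
  proof -
    have "g (g x) = A *v x" for x
    proof -
      interpret g: linear g by fact
      have "g (g x) = g (g (\<Sum>e\<in>E. (x \<bullet> e) *\<^sub>R e))" by (simp add: E)
      also have "\<dots> = (\<Sum>e\<in>E. (x \<bullet> e) *\<^sub>R (A *v e))"
        using l by (auto simp: g.sum g.scaleR ge E(3) less_imp_le intro!: sum.cong)
      also have "\<dots> = A *v (\<Sum>e\<in>E. (x \<bullet> e) *\<^sub>R e)"
        by (simp add: linear_sum[OF matrix_vector_mul_linear] matrix_vector_mult_scaleR)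
      finally show ?thesis by (simp add: E)
    qed
    then show ?thesis by (simp add: matrix_eq B flip: matrix_vector_mul_assoc)
  qed
  ultimately show ?thesis by blast
qed

text \<open>Works on an eigenbasis of the symmetric difference \<open>B - C\<close>. For an
  eigenvector \<open>e\<close> with eigenvalue \<open>l\<close>, equal squares give
  \<open>B *v e\<close> and \<open>C *v e\<close> the same norm, that is
  \<open>l * (e \<bullet> (B *v e) + e \<bullet> (C *v e)) = 0\<close>, and the bracket is
  positive.\<close>

lemma pos_def_sqrt_unique:
  fixes B C :: "real^'n^'n"
  assumes B: "pos_def B" and C: "pos_def C" and eq: "B ** B = C ** C"
  shows "B = C"
proof -
  let ?M = "B - C"
  obtain E l where E: "finite E" "\<And>e. e \<in> E \<Longrightarrow> norm e = 1" "\<And>e. e \<in> E \<Longrightarrow> ?M *v e = l e *\<^sub>R e"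
    "\<And>x. (\<Sum>e\<in>E. (x \<bullet> e) *\<^sub>R e) = x"
  proof (rule selfadjoint_eigenbasis[OF matrix_vector_mul_linear[of ?M]])
    show "(?M *v x) \<bullet> y = x \<bullet> (?M *v y)" for x y
      by (simp add: matrix_vector_mult_diff_rdistrib inner_simps pos_def_sym[OF B] pos_def_sym[OF C])
  qed blast
  have M: "?M *v e = 0" if "e \<in> E" for e
  proof -
    have e: "e \<noteq> 0" using E(2)[OF that] by auto
    have 1: "B *v e = C *v e + l e *\<^sub>R e"
      using E(3)[OF that] by (simp add: matrix_vector_mult_diff_rdistrib algebra_simps)
    have "(B *v e) \<bullet> (B *v e) = (C *v e) \<bullet> (C *v e)"
      using pos_def_sym[OF B] pos_def_sym[OF C] eq by (metis matrix_vector_mul_assoc)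
    then have "l e * (e \<bullet> (B *v e) + e \<bullet> (C *v e)) = 0"
      by (simp add: 1 inner_simps algebra_simps inner_commute)
    moreover have "0 < e \<bullet> (B *v e) + e \<bullet> (C *v e)"
      using pos_def_pos[OF B e] pos_def_pos[OF C e] by simp
    ultimately show ?thesis using E(3)[OF that] by simp
  qed
  have "?M *v x = 0" for x
  proof -
    have "?M *v x = ?M *v (\<Sum>e\<in>E. (x \<bullet> e) *\<^sub>R e)" by (simp add: E)
    also have "\<dots> = (\<Sum>e\<in>E. (x \<bullet> e) *\<^sub>R (?M *v e))"
      by (simp add: linear_sum[OF matrix_vector_mul_linear] matrix_vector_mult_scaleR)
    finally show ?thesis using M by simp
  qed
  then show "B = C"
    by (simp add: matrix_eq matrix_vector_mult_diff_rdistrib)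
qed

lemma msqrt:
  assumes "pos_def A"
  shows "pos_def (msqrt A)" "msqrt A ** msqrt A = A"
proof -
  have "\<exists>!B. pos_def B \<and> B ** B = A"
    using pos_def_sqrt_exists[OF assms] pos_def_sqrt_unique by metis
  from theI'[OF this] show "pos_def (msqrt A)" "msqrt A ** msqrt A = A"
    by (auto simp: msqrt_def)
qed

lemma matrix_inv_mul:
  fixes A :: "real^'n^'n"
  assumes "invertible A"
  shows "A ** matrix_inv A = mat 1" "matrix_inv A ** A = mat 1"
  using someI_ex[of "\<lambda>A'. A ** A' = mat 1 \<and> A' ** A = mat 1"] assms
  by (auto simp: matrix_inv_def invertible_def)

lemma matrix_inv_mul_vec:
  fixes A :: "real^'n^'n"
  assumes "invertible A"
  shows "A *v (matrix_inv A *v x) = x" "matrix_inv A *v (A *v x) = x"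
  using matrix_inv_mul[OF assms] by (simp_all add: matrix_vector_mul_assoc)

lemma matrix_inv_unique_real:
  fixes A B :: "real^'n^'n"
  assumes "A ** B = mat 1" shows "matrix_inv A = B" "invertible A"
proof -
  show "invertible A" using assms invertible_right_inverse by blast
  then show "matrix_inv A = B"
    using matrix_inv_mul[of A] assms by (metis matrix_mul_assoc matrix_mul_lid matrix_mul_rid)
qed

lemma pos_def_invertible:
  fixes A :: "real^'n^'n"
  assumes "pos_def A"
  shows "invertible A"
proof -
  have "x = 0" if "A *v x = 0" for x
    using pos_def_pos[OF assms, of x] that by (cases "x = 0") auto
  then show ?thesis by (metis matrix_left_invertible_ker invertible_left_inverse)
qed

lemma pos_def_inv_sym:
  assumes "pos_def A" shows "(matrix_inv A *v x) \<bullet> y = x \<bullet> (matrix_inv A *v y)"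
  using pos_def_sym[OF assms, of "matrix_inv A *v x" "matrix_inv A *v y"]
    matrix_inv_mul_vec[OF pos_def_invertible[OF assms]] by simp

lemma pos_def_matrix_inv:
  assumes "pos_def A" shows "pos_def (matrix_inv A)"
proof (rule pos_defI)
  show "0 < x \<bullet> (matrix_inv A *v x)" if "x \<noteq> 0" for x
    using pos_def_pos[OF assms, of "matrix_inv A *v x"] that
      matrix_inv_mul_vec[OF pos_def_invertible[OF assms], of x]
    by (metis inner_commute matrix_vector_mult_0_right)
qed (rule pos_def_inv_sym[OF assms])

lemma matrix_inv_minvsqrt: "pos_def A \<Longrightarrow> matrix_inv (minvsqrt A) = msqrt A"
  unfolding minvsqrt_def
  by (intro matrix_inv_unique_real matrix_inv_mul pos_def_invertible msqrt)

lemma minvsqrt_quadratic: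
  assumes A: "pos_def A"
  shows "(minvsqrt A *v z) \<bullet> (A *v (minvsqrt A *v z)) = z \<bullet> z"
proof -
  note m = msqrt[OF A]
  let ?y = "minvsqrt A *v z"
  have "msqrt A *v ?y = z"
    unfolding minvsqrt_def by (rule matrix_inv_mul_vec[OF pos_def_invertible[OF m(1)]])
  moreover have "?y \<bullet> (A *v ?y) = (msqrt A *v ?y) \<bullet> (msqrt A *v ?y)"
    using m(2) pos_def_sym[OF m(1)] by (metis matrix_vector_mul_assoc)
  ultimately show ?thesis by simp
qed

section \<open>Block matrices and Schur complements\<close>

lemma vfst_nth [simp]: "vfst v $ i = v $ Inl i" by (simp add: vfst_def)
lemma vsnd_nth [simp]: "vsnd v $ i = v $ Inr i" by (simp add: vsnd_def)
lemma vjoin_Inl [simp]: "vjoin a b $ Inl i = a $ i" by (simp add: vjoin_def)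
lemma vjoin_Inr [simp]: "vjoin a b $ Inr i = b $ i" by (simp add: vjoin_def)

lemma vec_sum_eq_iff: "v = w \<longleftrightarrow> vfst v = vfst w \<and> vsnd v = vsnd w"
  by (auto simp: vec_eq_iff) (metis sum.exhaust)

lemma vfst_vjoin [simp]: "vfst (vjoin a b) = a" and vsnd_vjoin [simp]: "vsnd (vjoin a b) = b"
  by (simp_all add: vec_eq_iff)

lemma vjoin_collapse [simp]: "vjoin (vfst v) (vsnd v) = v"
  by (simp add: vec_sum_eq_iff)

lemma vfst_simps [simp]: "vfst (v + w) = vfst v + vfst w" "vfst (v - w) = vfst v - vfst w"
    "vfst (c *\<^sub>R v) = c *\<^sub>R vfst v" "vfst (- v) = - vfst v" "vfst 0 = 0"
  and vsnd_simps [simp]: "vsnd (v + w) = vsnd v + vsnd w" "vsnd (v - w) = vsnd v - vsnd w"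
    "vsnd (c *\<^sub>R v) = c *\<^sub>R vsnd v" "vsnd (- v) = - vsnd v" "vsnd 0 = 0"
  by (simp_all add: vec_eq_iff)

lemma linear_vfst: "linear vfst" and linear_vsnd: "linear vsnd"
  by (auto intro!: linearI)

lemma linear_vjoin: "linear (\<lambda>x. vjoin (f x) (g x))" if "linear f" "linear g"
  using that by (auto intro!: linearI simp: vec_sum_eq_iff linear_add linear_scale)

lemma inner_vec_sum: "v \<bullet> w = vfst v \<bullet> vfst w + vsnd v \<bullet> vsnd w"
  by (simp add: inner_vec_def UNIV_Plus_UNIV[symmetric] sum.Plus del: UNIV_Plus_UNIV)

lemma matrix_vector_mult_blocks:
  "M *v v = vjoin (blk11 M *v vfst v + blk12 M *v vsnd v) (blk21 M *v vfst v + blk22 M *v vsnd v)"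
  by (auto simp: vec_eq_iff matrix_vector_mult_def vjoin_def blk11_def blk12_def blk21_def blk22_def
      UNIV_Plus_UNIV[symmetric] sum.Plus simp del: UNIV_Plus_UNIV split: sum.split)

definition schur :: "real^('a::finite + 'b::finite)^('a + 'b) \<Rightarrow> real^'b^'b" where
  "schur Q = blk22 Q - blk21 Q ** matrix_inv (blk11 Q) ** blk12 Q"

text \<open>The coefficients \<open>Q11^-1 Q12\<close> of a regression of the second block of
  columns on the first. The map \<open>B\<close> of \<open>limit_law\<close> is
  \<open>v \<mapsto> vjoin (regr Q v) (- v)\<close>.\<close>

definition regr :: "real^('a::finite + 'b::finite)^('a + 'b) \<Rightarrow> real^'b \<Rightarrow> real^'a" where
  "regr Q v = matrix_inv (blk11 Q) *v (blk12 Q *v v)"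

lemma linear_regr: "linear (regr Q)"
  unfolding regr_def by (auto intro!: linearI simp: matrix_vector_right_distrib matrix_vector_mult_scaleR)

lemma schur_mult: "schur Q *v v = blk22 Q *v v - blk21 Q *v regr Q v"
  by (simp add: schur_def regr_def matrix_vector_mult_diff_rdistrib flip: matrix_vector_mul_assoc)

lemma pos_def_blk12: "pos_def Q \<Longrightarrow> x \<bullet> (blk12 Q *v y) = y \<bullet> (blk21 Q *v x)"
  using pos_def_sym[of Q "vjoin x 0" "vjoin 0 y"]
  by (simp add: matrix_vector_mult_blocks inner_vec_sum inner_commute)

lemma pos_def_blk11:
  assumes Q: "pos_def Q" shows "pos_def (blk11 Q)"
proof (rule pos_defI)
  show "(blk11 Q *v x) \<bullet> y = x \<bullet> (blk11 Q *v y)" for x y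
    using pos_def_sym[OF Q, of "vjoin x 0" "vjoin y 0"] by (simp add: matrix_vector_mult_blocks inner_vec_sum)
  fix x :: "real^'a" assume "x \<noteq> 0"
  then have "vjoin x (0::real^'b) \<noteq> 0" by (simp add: vec_sum_eq_iff)
  from pos_def_pos[OF Q this] show "0 < x \<bullet> (blk11 Q *v x)"
    by (simp add: matrix_vector_mult_blocks inner_vec_sum)
qed

lemma blk11_regr: "pos_def Q \<Longrightarrow> blk11 Q *v regr Q v = blk12 Q *v v"
  unfolding regr_def by (rule matrix_inv_mul_vec) (intro pos_def_invertible pos_def_blk11)

lemma pos_def_blk22_sym:
  assumes Q: "pos_def Q" shows "(blk22 Q *v x) \<bullet> y = x \<bullet> (blk22 Q *v y)"
  using pos_def_sym[OF Q, of "vjoin 0 x" "vjoin 0 y"] by (simp add: matrix_vector_mult_blocks inner_vec_sum)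

text \<open>Block diagonalisation of the precision matrix: \<open>vfst v + regr Q (vsnd v)\<close>
  and \<open>vsnd v\<close> decouple. Positivity of the Schur complement, the whitening map and the
  loss in the weight all rest on it.\<close>

lemma quadratic_form_complete_square:
  assumes Q: "pos_def Q"
  shows "v \<bullet> (Q *v v) = (vfst v + regr Q (vsnd v)) \<bullet> (blk11 Q *v (vfst v + regr Q (vsnd v)))
    + vsnd v \<bullet> (schur Q *v vsnd v)"
  using pos_def_sym[OF pos_def_blk11[OF Q], of "regr Q (vsnd v)" "vfst v"]
    pos_def_blk12[OF Q, of "vfst v" "vsnd v"] pos_def_blk12[OF Q, of "regr Q (vsnd v)" "vsnd v"]
  by (simp add: inner_vec_sum matrix_vector_mult_blocks schur_mult matrix_vector_right_distrib
      blk11_regr[OF Q] inner_simps inner_commute)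

lemma pos_def_schur:
  assumes Q: "pos_def Q" shows "pos_def (schur Q)"
proof (rule pos_defI)
  fix x y
  have "(blk21 Q *v regr Q x) \<bullet> y = regr Q x \<bullet> (blk11 Q *v regr Q y)" for x y
    using pos_def_blk12[OF Q, of "regr Q x" y] by (simp add: blk11_regr[OF Q] inner_commute)
  then have "(blk21 Q *v regr Q x) \<bullet> y = x \<bullet> (blk21 Q *v regr Q y)"
    using pos_def_sym[OF pos_def_blk11[OF Q], of "regr Q x" "regr Q y"] by (metis inner_commute)
  then show "(schur Q *v x) \<bullet> y = x \<bullet> (schur Q *v y)"
    by (simp add: schur_mult inner_simps pos_def_blk22_sym[OF Q])
next
  fix x :: "real^'b" assume "x \<noteq> 0"
  \<comment> \<open>At this vector the first square vanishes, so the full form reduces to the Schur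
    form.\<close>
  then have "vjoin (- regr Q x) x \<noteq> 0" by (simp add: vec_sum_eq_iff)
  from pos_def_pos[OF Q this] show "0 < x \<bullet> (schur Q *v x)"
    by (simp add: quadratic_form_complete_square[OF Q])
qed

text \<open>A block triangular linear map \<open>T\<close> with \<open>T' Q T = I\<close>; it turns \<open>(Z\<^sub>1, Z\<^sub>2)\<close> into \<open>C\<^sub>\<infinity> Z\<^sub>1 + D\<^sub>\<infinity> Z\<^sub>2\<close>.\<close>

definition whiten :: "real^('a::finite + 'b::finite)^('a + 'b) \<Rightarrow> real^('a + 'b) \<Rightarrow> real^('a + 'b)" where
  "whiten Q z = vjoin (minvsqrt (blk11 Q) *v vfst z - regr Q (minvsqrt (schur Q) *v vsnd z)) (minvsqrt (schur Q) *v vsnd z)"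

lemma linear_whiten: "linear (whiten Q)"
  unfolding whiten_def
  by (auto intro!: linearI simp: vec_sum_eq_iff matrix_vector_right_distrib matrix_vector_mult_scaleR
      linear_add[OF linear_regr] linear_scale[OF linear_regr] algebra_simps)

lemma whiten_quadratic:
  assumes Q: "pos_def Q"
  shows "whiten Q z \<bullet> (Q *v whiten Q z) = z \<bullet> z"
  by (simp add: quadratic_form_complete_square[OF Q] whiten_def inner_vec_sum[of z z]
      minvsqrt_quadratic pos_def_blk11[OF Q] pos_def_schur[OF Q])

text \<open>Polarising the hypothesis gives \<open>T' Q T = I\<close>; then take determinants. The
  equation also forces \<open>det Q\<close> to be positive, which is used later.\<close>

lemma det_whitening_map:
  fixes T :: "real^'n \<Rightarrow> real^'n"
  assumes Q: "pos_def Q" and T: "linear T" and quad: "\<And>z. T z \<bullet> (Q *v T z) = z \<bullet> z"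
  shows "(det (matrix T))\<^sup>2 * det Q = 1"
proof -
  let ?M = "transpose (matrix T) ** Q ** matrix T"
  have tr: "x \<bullet> (transpose N *v w) = (N *v x) \<bullet> w" for N :: "real^'n^'n" and x w
    using dot_lmul_matrix[of w N x] by (simp add: transpose_matrix_vector inner_commute)
  have M: "x \<bullet> (?M *v y) = T x \<bullet> (Q *v T y)" for x y
    using T tr[of x "matrix T" "Q *v T y"] by (simp flip: matrix_vector_mul_assoc)
  have "x \<bullet> (?M *v y) = x \<bullet> y" for x y
  proof -
    have "T y \<bullet> (Q *v T x) = T x \<bullet> (Q *v T y)"
      using pos_def_sym[OF Q, of "T y" "T x"] by (metis inner_commute)
    then show ?thesis
      using quad[of "x + y"] quad[of x] quad[of y] inner_commute[of y x]
      by (simp add: M linear_add[OF T] matrix_vector_right_distrib inner_add_left inner_add_right)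
  qed
  then have "?M *v y = y" for y
    by (subst vector_eq_ldot[symmetric]) simp
  then have "?M = mat 1" by (simp add: matrix_eq)
  then have "det ?M = 1" by simp
  then show ?thesis by (simp add: det_mul power2_eq_square mult_ac)
qed

section \<open>Limits of matrices, of their determinants and of their inverses\<close>

lemma norm_matrix_vector_le:
  fixes A :: "real^'n^'m"
  shows "norm (A *v x) \<le> real CARD('m) * norm A * norm x"
proof -
  have "norm (A *v x) \<le> (\<Sum>i\<in>UNIV. norm ((A *v x) $ i))"
    by (simp add: norm_vec_def L2_set_le_sum)
  also have "\<dots> \<le> (\<Sum>i\<in>(UNIV::'m set). norm A * norm x)"
  proof (rule sum_mono)
    fix i
    have "norm ((A *v x) $ i) = \<bar>A $ i \<bullet> x\<bar>" by (simp add: matrix_vector_mul_component)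
    also have "\<dots> \<le> norm (A $ i) * norm x" by (rule Cauchy_Schwarz_ineq2)
    also have "\<dots> \<le> norm A * norm x" by (intro mult_right_mono Finite_Cartesian_Product.norm_nth_le) auto
    finally show "norm ((A *v x) $ i) \<le> norm A * norm x" .
  qed
  finally show ?thesis by simp
qed

lemma tendsto_matrix_vector_mult:
  fixes A :: "'i \<Rightarrow> real^'n^'m"
  assumes "(A \<longlongrightarrow> a) F" "(x \<longlongrightarrow> y) F"
  shows "((\<lambda>i. A i *v x i) \<longlongrightarrow> a *v y) F"
  unfolding matrix_vector_mult_def
  by (intro tendsto_vec_lambda tendsto_sum tendsto_mult tendsto_vec_nth assms)

lemma tendsto_det:
  fixes A :: "'i \<Rightarrow> real^'n^'n"
  assumes "(A \<longlongrightarrow> a) F"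
  shows "((\<lambda>i. det (A i)) \<longlongrightarrow> det a) F"
  unfolding det_def
  by (intro tendsto_sum tendsto_mult tendsto_const tendsto_prod tendsto_vec_nth assms)

text \<open>The constant is the minimum of the form on the unit sphere, attained by compactness and
  extended by homogeneity.\<close>

lemma pos_def_lower_bound:
  fixes A :: "real^'n^'n"
  assumes "pos_def A"
  obtains c where "0 < c" "\<And>x. c * (norm x)\<^sup>2 \<le> x \<bullet> (A *v x)"
proof -
  let ?K = "sphere (0::real^'n) 1"
  have "axis undefined 1 \<in> ?K" by (simp add: norm_axis_1)
  then have "?K \<noteq> {}" by blast
  moreover have "continuous_on ?K (\<lambda>x. x \<bullet> (A *v x))" by (intro continuous_intros)
  ultimately obtain e where e: "e \<in> ?K" and min: "\<And>x. x \<in> ?K \<Longrightarrow> e \<bullet> (A *v e) \<le> x \<bullet> (A *v x)"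
    using continuous_attains_inf[of ?K] compact_sphere by blast
  show ?thesis
  proof (rule that[of "e \<bullet> (A *v e)"])
    show "0 < e \<bullet> (A *v e)" using e by (intro pos_def_pos assms) auto
    show "e \<bullet> (A *v e) * (norm x)\<^sup>2 \<le> x \<bullet> (A *v x)" for x
    proof (cases "x = 0")
      case False
      have "e \<bullet> (A *v e) \<le> ((1 / norm x) *\<^sub>R x) \<bullet> (A *v ((1 / norm x) *\<^sub>R x))"
        by (rule min) (use False in simp)
      then show ?thesis
        using False by (simp add: matrix_vector_mult_scaleR field_simps power2_eq_square)
    qed simp
  qed
qed

text \<open>One constant serves all large \<open>n\<close>. It yields the Gaussian dominating
  function, the continuity of inversion, and the bound on the correction when the local parameter
  diverges.\<close>

lemma pos_def_eventually_lower_bound: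
  fixes A :: "nat \<Rightarrow> real^'n^'n"
  assumes lim: "A \<longlonglongrightarrow> a" and "pos_def a"
  obtains c where "0 < c" "\<forall>\<^sub>F n in sequentially. \<forall>x. c * (norm x)\<^sup>2 \<le> x \<bullet> (A n *v x)"
proof -
  obtain c where c: "0 < c" "\<And>x. c * (norm x)\<^sup>2 \<le> x \<bullet> (a *v x)"
    using pos_def_lower_bound[OF \<open>pos_def a\<close>] by blast
  let ?k = "real CARD('n)"
  have "(\<lambda>n. norm (A n - a)) \<longlonglongrightarrow> 0"
    using lim by (simp add: tendsto_norm_zero_iff LIM_zero)
  \<comment> \<open>The threshold absorbs the factor \<open>?k\<close> of
    \<open>norm_matrix_vector_le\<close>, so the perturbation costs at most half of
    \<open>c\<close>.\<close>
  then have "\<forall>\<^sub>F n in sequentially. norm (A n - a) < c / (2 * ?k)"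
    using c by (intro order_tendstoD) auto
  then have "\<forall>\<^sub>F n in sequentially. \<forall>x. c / 2 * (norm x)\<^sup>2 \<le> x \<bullet> (A n *v x)"
  proof eventually_elim
    case (elim n)
    show ?case
    proof
      fix x
      have "\<bar>x \<bullet> ((A n - a) *v x)\<bar> \<le> norm x * (?k * norm (A n - a) * norm x)"
        by (meson Cauchy_Schwarz_ineq2 mult_left_mono norm_ge_zero norm_matrix_vector_le order_trans)
      also have "\<dots> = (?k * norm (A n - a)) * (norm x)\<^sup>2" by (simp add: power2_eq_square)
      also have "\<dots> \<le> c / 2 * (norm x)\<^sup>2"
        using elim by (intro mult_right_mono) (auto simp: field_simps)
      finally have "\<bar>x \<bullet> (A n *v x) - x \<bullet> (a *v x)\<bar> \<le> c / 2 * (norm x)\<^sup>2"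
        by (simp add: matrix_vector_mult_diff_rdistrib inner_diff_right)
      with c(2)[of x] show "c / 2 * (norm x)\<^sup>2 \<le> x \<bullet> (A n *v x)" by linarith
    qed
  qed
  with c show ?thesis by (intro that[of "c / 2"]) auto
qed

text \<open>The error \<open>d\<close> of the solution satisfies \<open>A n *v d = r\<close> with a
  residual \<open>r\<close> tending to zero, and
  \<open>c * (norm d)\<^sup>2 \<le> d \<bullet> r\<close> bounds \<open>norm d\<close> by
  \<open>norm r / c\<close>.\<close>

lemma tendsto_matrix_inv_vec:
  fixes A :: "nat \<Rightarrow> real^'n^'n"
  assumes lim: "A \<longlonglongrightarrow> a" and a: "pos_def a" and b: "b \<longlonglongrightarrow> b'"
    and A: "\<forall>\<^sub>F n in sequentially. pos_def (A n)"
  shows "(\<lambda>n. matrix_inv (A n) *v b n) \<longlonglongrightarrow> matrix_inv a *v b'"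
proof -
  obtain c where c: "0 < c" and ev: "\<forall>\<^sub>F n in sequentially. \<forall>x. c * (norm x)\<^sup>2 \<le> x \<bullet> (A n *v x)"
    using pos_def_eventually_lower_bound[OF lim a] by blast
  let ?x = "matrix_inv a *v b'" and ?r = "\<lambda>n. b n - A n *v (matrix_inv a *v b')"
  have "?r \<longlonglongrightarrow> b' - a *v ?x"
    by (intro tendsto_diff b tendsto_matrix_vector_mult lim tendsto_const)
  then have "(\<lambda>n. norm (?r n) / c) \<longlonglongrightarrow> 0"
    using matrix_inv_mul_vec[OF pos_def_invertible[OF a]] by (simp add: tendsto_divide_zero tendsto_norm_zero)
  moreover have "\<forall>\<^sub>F n in sequentially. norm (matrix_inv (A n) *v b n - ?x) \<le> norm (?r n) / c"
    using ev A
  proof eventually_elim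
    case (elim n)
    let ?d = "matrix_inv (A n) *v b n - ?x"
    have "A n *v ?d = ?r n"
      using matrix_inv_mul_vec[OF pos_def_invertible[OF elim(2)]] by (simp add: matrix_vector_mult_diff_distrib)
    then have "c * (norm ?d)\<^sup>2 \<le> ?d \<bullet> ?r n" using elim(1) by metis
    also have "\<dots> \<le> norm ?d * norm (?r n)" by (rule norm_cauchy_schwarz)
    finally have "norm ?d * (c * norm ?d) \<le> norm ?d * norm (?r n)" by (simp add: power2_eq_square mult_ac)
    then have "c * norm ?d \<le> norm (?r n)"
      by (cases "norm ?d = 0") (auto simp: mult_le_cancel_left)
    then show ?case using c by (simp add: field_simps)
  qed
  ultimately have "(\<lambda>n. matrix_inv (A n) *v b n - ?x) \<longlonglongrightarrow> 0"
    by (rule Lim_null_comparison[rotated])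
  then show ?thesis by (simp add: LIM_zero_cancel)
qed

section \<open>Gaussian laws\<close>

text \<open>Density of \<open>N(0, \<sigma>\<^sup>2 Q\<^sup>-\<^sup>1)\<close>: the matrix argument is the precision, not the covariance.\<close>

definition gdens :: "real \<Rightarrow> real^'n^'n \<Rightarrow> real^'n::finite \<Rightarrow> real" where
  "gdens \<sigma> Q v = (2 * pi * \<sigma>\<^sup>2) powr (- real CARD('n) / 2) * sqrt (det Q) * exp (- (v \<bullet> (Q *v v)) / (2 * \<sigma>\<^sup>2))"

lemma measurable_gdens [measurable]: "gdens \<sigma> Q \<in> borel_measurable borel"
proof -
  have [measurable]: "(\<lambda>v. v \<bullet> (Q *v v)) \<in> borel_measurable borel"
    by (intro borel_measurable_continuous_onI continuous_intros)
  show ?thesis unfolding gdens_def by measurable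
qed

lemma prod_normal_density:
  fixes z :: "real^'n"
  assumes "0 < \<sigma>"
  shows "(\<Prod>i\<in>UNIV. normal_density 0 \<sigma> (z $ i)) = gdens \<sigma> (mat 1) z"
proof -
  have "(1 / sqrt (2 * pi * \<sigma>\<^sup>2)) ^ CARD('n) = (2 * pi * \<sigma>\<^sup>2) powr (- real CARD('n) / 2)"
  proof -
    have "1 / sqrt (2 * pi * \<sigma>\<^sup>2) = (2 * pi * \<sigma>\<^sup>2) powr (- 1 / 2)"
      using assms by (simp add: powr_minus_divide powr_half_sqrt)
    then show ?thesis
      using assms by (simp add: powr_power)
  qed
  moreover have "(\<Prod>i\<in>UNIV. exp (- (z $ i)\<^sup>2 / (2 * \<sigma>\<^sup>2))) = exp (- (z \<bullet> z) / (2 * \<sigma>\<^sup>2))"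
    by (simp add: exp_sum[symmetric] inner_vec_def power2_eq_square sum_negf sum_divide_distrib)
  ultimately show ?thesis
    by (simp only: normal_density_def prod.distrib prod_constant diff_0_right) (simp add: gdens_def)
qed

lemma gaussI_eq: "0 < \<sigma> \<Longrightarrow> gaussI \<sigma> = density lborel (\<lambda>z. ennreal (gdens \<sigma> (mat 1) z))"
  by (simp add: gaussI_def prod_normal_density)

lemma sets_gaussI [simp, measurable_cong]: "sets (gaussI \<sigma>) = sets borel"
  and space_gaussI [simp]: "space (gaussI \<sigma>) = UNIV"
  by (simp_all add: gaussI_def)

lemma nn_integral_normal_density:
  "0 < \<sigma> \<Longrightarrow> (\<integral>\<^sup>+x. ennreal (normal_density \<mu> \<sigma> x) \<partial>lborel) = 1"
  using prob_space.emeasure_space_1[OF prob_space_normal_density, of \<sigma> \<mu>]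
  by (simp add: emeasure_density)

lemma prob_space_gaussI:
  assumes "0 < \<sigma>" shows "prob_space (gaussI \<sigma> :: (real^'n) measure)"
proof
  have *: "(\<Prod>i\<in>UNIV. normal_density 0 \<sigma> (z $ i)) = (\<Prod>b\<in>Basis. normal_density 0 \<sigma> (z \<bullet> b))" for z :: "real^'n"
    by (rule prod.reindex_bij_witness[of _ "\<lambda>b. THE i. b = axis i 1" "\<lambda>i. axis i 1"])
       (auto simp: axis_eq_axis Basis_vec_def inner_axis)
  have "emeasure (gaussI \<sigma> :: (real^'n) measure) (space (gaussI \<sigma>)) =
      (\<integral>\<^sup>+z. (\<Prod>b\<in>Basis. ennreal (normal_density 0 \<sigma> (z \<bullet> b))) \<partial>(lborel :: (real^'n) measure))"
    by (simp add: gaussI_def emeasure_density * prod_ennreal)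
  also have "\<dots> = (\<Prod>b\<in>(Basis::(real^'n) set). (\<integral>\<^sup>+x. ennreal (normal_density 0 \<sigma> x) \<partial>lborel))"
    by (rule nn_integral_lborel_prod) auto
  finally show "emeasure (gaussI \<sigma>) (space (gaussI \<sigma> :: (real^'n) measure)) = 1"
    using assms by (simp add: nn_integral_normal_density)
qed

lemma integrable_gdens_mat_1:
  assumes "0 < \<sigma>" shows "integrable lborel (gdens \<sigma> (mat 1) :: real^'n \<Rightarrow> real)"
proof (rule integrableI_nonneg)
  interpret prob_space "gaussI \<sigma> :: (real^'n) measure" by (rule prob_space_gaussI[OF assms])
  have "(\<integral>\<^sup>+x. ennreal (gdens \<sigma> (mat 1) (x::real^'n)) \<partial>lborel) = 1"
    using emeasure_space_1 by (simp add: gaussI_eq[OF assms] emeasure_density)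
  then show "(\<integral>\<^sup>+x. ennreal (gdens \<sigma> (mat 1) (x::real^'n)) \<partial>lborel) < \<infinity>" by simp
qed (auto simp: gdens_def)

text \<open>Change of variables with the constant Jacobian \<open>1 / sqrt (det Q)\<close>. Being
  the image of a probability measure, the right-hand side is automatically normalised.\<close>

lemma distr_gaussI_linear:
  fixes T :: "real^'n \<Rightarrow> real^'n"
  assumes \<sigma>: "0 < \<sigma>" and Q: "pos_def Q" and T: "linear T" and quad: "\<And>z. T z \<bullet> (Q *v T z) = z \<bullet> z"
  shows "distr (gaussI \<sigma>) borel T = density lborel (\<lambda>v. ennreal (gdens \<sigma> Q v))"
  unfolding gaussI_eq[OF \<sigma>]
proof (rule distr_density_change_of_variables(2))
  have det: "(det (matrix T))\<^sup>2 * det Q = 1" by (rule det_whitening_map[OF Q T quad])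
  show "(T has_derivative T) (at x)" for x
    using T by (simp add: bounded_linear_imp_has_derivative linear_conv_bounded_linear)
  have "inj T" using det T by (metis det_nz_iff_inj mult_zero_left power_zero_numeral zero_neq_one)
  then show "bij T" using T by (simp add: bij_def linear_injective_imp_surjective)
  show "0 < \<bar>det (matrix T)\<bar>" using det by auto
  have "\<bar>det (matrix T)\<bar> * sqrt (det Q) = 1"
    using det by (metis real_sqrt_abs real_sqrt_mult real_sqrt_one)
  then show "\<bar>det (matrix T)\<bar> * gdens \<sigma> Q (T x) = gdens \<sigma> (mat 1) x" for x
    by (simp add: gdens_def quad algebra_simps)
  show "0 \<le> gdens \<sigma> (mat 1) x" for x :: "real^'n" by (simp add: gdens_def)
qed (auto simp: integrable_gdens_mat_1 \<sigma>)

section \<open>Rotations, and reduction of the number of Gaussian coordinates\<close>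

lemma distr_gaussI_orthogonal:
  fixes T :: "real^'n \<Rightarrow> real^'n"
  assumes "0 < \<sigma>" and "orthogonal_transformation T"
  shows "distr (gaussI \<sigma>) borel T = gaussI \<sigma>"
  using distr_gaussI_linear[of \<sigma> "mat 1" T] assms
  by (simp add: gaussI_eq orthogonal_transformation_def pos_def_def transpose_mat)

text \<open>The type \<open>'k option\<close> has exactly one index more than \<open>'k\<close>, so
  an induction over observations can adjoin the newest error as a coordinate. The argument is a pair
  because the map is applied to a product measure.\<close>

definition vcons :: "real \<times> (real^'k::finite) \<Rightarrow> real^('k option)" where
  "vcons = (\<lambda>(u, z). \<chi> j. case j of None \<Rightarrow> u | Some i \<Rightarrow> z $ i)"

lemma vcons_nth [simp]: "vcons (u, z) $ None = u" "vcons (u, z) $ Some i = z $ i"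
  by (simp_all add: vcons_def)

lemma vcons_eqI: "x $ None = u \<Longrightarrow> (\<And>i. x $ Some i = z $ i) \<Longrightarrow> x = vcons (u, z)"
  by (auto simp: vec_eq_iff vcons_def split: option.split)

lemma linear_vcons: "linear vcons"
  by (auto intro!: linearI simp: vec_eq_iff vcons_def split: option.split)

lemma measurable_vcons [measurable]: "vcons \<in> borel_measurable borel"
  using linear_vcons by (intro borel_measurable_continuous_onI linear_continuous_on) (simp add: linear_conv_bounded_linear)

lemma measurable_vcons_pair [measurable]: "vcons \<in> borel_measurable (borel \<Otimes>\<^sub>M borel)"
  using measurable_vcons by (simp add: borel_prod)

lemma prod_option: "(\<Prod>j\<in>UNIV. f j) = f None * (\<Prod>i\<in>UNIV. f (Some i))" for f :: "'k::finite option \<Rightarrow> 'a::comm_monoid_mult"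
  by (simp add: UNIV_option_conv prod.reindex)

lemma distr_lborel_vcons: "distr (lborel \<Otimes>\<^sub>M lborel) borel vcons = lborel"
proof (rule lborel_vec_eqI[symmetric])
  fix l u :: "real^('k::finite option)" assume le: "\<And>i. l $ i \<le> u $ i"
  let ?t = "\<lambda>x::real^('k option). \<chi> i. x $ Some i"
  have "vcons -` box l u = {l $ None <..< u $ None} \<times> box (?t l) (?t u)"
    by (auto simp: mem_box_cart split_option_all vcons_def)
  then have "emeasure (distr (lborel \<Otimes>\<^sub>M lborel) borel vcons) (box l u) =
      emeasure (lborel \<Otimes>\<^sub>M lborel) ({l $ None <..<u $ None} \<times> box (?t l) (?t u))"
    by (subst emeasure_distr) (auto simp: lborel_prod)
  also have "\<dots> = ennreal (u $ None - l $ None) * ennreal (\<Prod>i\<in>UNIV. u $ Some i - l $ Some i)"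
    using le by (subst lborel.emeasure_pair_measure_Times) (auto simp: emeasure_lborel_box_cart)
  also have "\<dots> = ennreal (\<Prod>i\<in>UNIV. u $ i - l $ i)"
    using le by (simp add: prod_option ennreal_mult prod_nonneg)
  finally show "emeasure (distr (lborel \<Otimes>\<^sub>M lborel) borel vcons) (box l u) = ennreal (\<Prod>i\<in>UNIV. u $ i - l $ i)" .
qed simp

lemma distr_gaussI_vcons:
  assumes "0 < \<sigma>"
  shows "distr (density lborel (normal_density 0 \<sigma>) \<Otimes>\<^sub>M (gaussI \<sigma> :: (real^'k) measure)) borel vcons = gaussI \<sigma>"
proof -
  interpret G: prob_space "gaussI \<sigma> :: (real^'k) measure" by (rule prob_space_gaussI[OF assms])
  let ?g = "\<lambda>z::real^'k. \<Prod>i\<in>UNIV. normal_density 0 \<sigma> (z $ i)"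
  have "gaussI \<sigma> = density (distr (lborel \<Otimes>\<^sub>M lborel) borel vcons)
      (\<lambda>x::real^('k option). ennreal (\<Prod>i\<in>UNIV. normal_density 0 \<sigma> (x $ i)))"
    by (simp add: distr_lborel_vcons gaussI_def)
  also have "\<dots> = distr (density (lborel \<Otimes>\<^sub>M lborel) (\<lambda>x. ennreal (\<Prod>i\<in>UNIV. normal_density 0 \<sigma> (vcons x $ i)))) borel vcons"
    by (rule density_distr) (auto simp: lborel_prod)
  also have "(\<lambda>x. ennreal (\<Prod>i\<in>UNIV. normal_density 0 \<sigma> (vcons x $ i))) =
      (\<lambda>(u, z::real^'k). ennreal (normal_density 0 \<sigma> u) * ennreal (?g z))"
    by (auto simp: prod_option ennreal_mult prod_nonneg fun_eq_iff)
  also have "density (lborel \<Otimes>\<^sub>M lborel) \<dots> = density lborel (normal_density 0 \<sigma>) \<Otimes>\<^sub>M gaussI \<sigma>"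
    unfolding gaussI_def
    by (rule pair_measure_density[symmetric])
       (auto intro: lborel.sigma_finite_measure_axioms G.sigma_finite_measure_axioms[unfolded gaussI_def])
  finally show ?thesis by simp
qed


text \<open>A kernel vector of \<open>T\<close> is rotated onto the extra coordinate, which then drops out.\<close>

lemma distr_gaussI_reduce:
  fixes T :: "real^('k option) \<Rightarrow> real^'k::finite"
  assumes \<sigma>: "0 < \<sigma>" and T: "linear T"
  shows "\<exists>B :: real^'k^'k. distr (gaussI \<sigma>) borel T = distr (gaussI \<sigma>) borel ((*v) B)
    \<and> (\<forall>x. norm (transpose B *v x) = norm (adjoint T x))"
proof -
  \<comment> \<open>The domain has one dimension more than the target.\<close>
  have "\<not> inj T"
  proof
    assume "inj T"
    then have "dim (range T) = dim (UNIV :: (real^('k option)) set)"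
      using T by (intro dim_image_eq) auto
    moreover have "dim (range T) \<le> DIM(real^'k)" by (rule dim_subset_UNIV)
    ultimately show False by (simp add: card_UNIV_option)
  qed
  then obtain w where w: "w \<noteq> 0" "T w = 0"
    using T by (auto simp: linear_injective_0)
  define v where "v = (1 / norm w) *\<^sub>R w"
  have v: "norm v = 1" "T v = 0"
    using w T by (auto simp: v_def linear_scale)
  have "norm (axis None 1 :: real^('k option)) = 1" by simp
  then obtain R :: "real^('k option) \<Rightarrow> real^('k option)"
    where R: "orthogonal_transformation R" "R (axis None 1) = v"
    using orthogonal_transformation_exists_1[OF _ v(1)] by blast
  have linR: "linear R" using R(1) by (rule orthogonal_transformation_linear)
  \<comment> \<open>\<open>g\<close> is \<open>T\<close> on the rotated hyperplane where the extra
    coordinate is zero. Since \<open>R\<close> sends the extra axis to the kernel vector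
    \<open>v\<close>, this captures all of \<open>T\<close>.\<close>
  define g where "g z = T (R (vcons (0, z)))" for z
  have "linear g"
  proof -
    have "linear (\<lambda>z::real^'k. vcons (0, z))"
      by (auto intro!: linearI simp: vec_eq_iff vcons_def split: option.split)
    then show ?thesis
      using linear_compose[OF linear_compose[OF _ linR] T] by (simp add: g_def[abs_def] o_def)
  qed
  define B where "B = matrix g"
  have B: "B *v z = g z" for z using \<open>linear g\<close> by (simp add: B_def)
  have TR: "T (R (vcons (u, z))) = B *v z" for u z
  proof -
    have "vcons (u, z) = vcons (0, z) + u *\<^sub>R axis None 1"
      by (intro vcons_eqI[symmetric]) (auto simp: axis_def)
    then show ?thesis
      using T linR by (simp add: linear_add linear_scale R(2) v(2) B g_def)
  qed
  interpret N: prob_space "density lborel (normal_density 0 \<sigma>)" by (rule prob_space_normal_density[OF \<sigma>])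
  interpret G: prob_space "gaussI \<sigma> :: (real^'k) measure" by (rule prob_space_gaussI[OF \<sigma>])
  let ?P = "density lborel (normal_density 0 \<sigma>) \<Otimes>\<^sub>M (gaussI \<sigma> :: (real^'k) measure)"
  have [measurable]: "T \<in> borel_measurable borel" "R \<in> borel_measurable borel"
    using T linR by (auto intro!: borel_measurable_continuous_onI linear_continuous_on simp: linear_conv_bounded_linear)
  have [measurable]: "(*v) B \<in> borel_measurable borel"
    by (intro borel_measurable_continuous_onI continuous_intros)
  have "distr (gaussI \<sigma>) borel T = distr (distr (gaussI \<sigma>) borel R) borel T"
    by (simp add: distr_gaussI_orthogonal[OF \<sigma> R(1)])
  also have "\<dots> = distr (distr (distr ?P borel vcons) borel R) borel T"
    by (simp add: distr_gaussI_vcons[OF \<sigma>])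
  also have "\<dots> = distr ?P borel (\<lambda>x. B *v snd x)"
    by (subst distr_distr; (measurable)?)+ (auto intro!: distr_cong simp: TR)
  also have "\<dots> = distr (distr ?P (gaussI \<sigma>) snd) borel ((*v) B)"
    by (subst distr_distr) (auto simp: o_def)
  also have "distr ?P (gaussI \<sigma>) snd = gaussI \<sigma>"
  proof (rule measure_eqI)
    fix A :: "(real^'k) set" assume "A \<in> sets (distr ?P (gaussI \<sigma>) snd)"
    then have [measurable]: "A \<in> sets (gaussI \<sigma>)" by simp
    have "snd -` A \<inter> space ?P = UNIV \<times> A" by (auto simp: space_pair_measure)
    then have "emeasure (distr ?P (gaussI \<sigma>) snd) A = emeasure ?P (UNIV \<times> A)"
      using \<open>A \<in> sets (gaussI \<sigma>)\<close> by (subst emeasure_distr[OF measurable_snd]) auto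
    also have "\<dots> = emeasure (density lborel (normal_density 0 \<sigma>)) UNIV * emeasure (gaussI \<sigma>) A"
      using \<open>A \<in> sets (gaussI \<sigma>)\<close> by (intro G.emeasure_pair_measure_Times) auto
    finally show "emeasure (distr ?P (gaussI \<sigma>) snd) A = emeasure (gaussI \<sigma>) A"
      using N.emeasure_space_1 by simp
  qed simp
  finally have 1: "distr (gaussI \<sigma>) borel T = distr (gaussI \<sigma>) borel ((*v) B)" .
  \<comment> \<open>The covariance is preserved: rotated back by \<open>R\<close>, the vector
    \<open>adjoint T x\<close> has extra coordinate \<open>x \<bullet> T v = 0\<close>, and its
    other coordinates form \<open>transpose B *v x\<close>.\<close>
  have 2: "norm (transpose B *v x) = norm (adjoint T x)" for x
  proof -
    let ?s = "adjoint T x"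
    obtain t where t: "?s = R t" using orthogonal_transformation_surj[OF R(1)] by (metis surjD)
    have tz: "t \<bullet> z = x \<bullet> T (R z)" for z
      using R(1) adjoint_works[OF T, of "R z" x] by (metis orthogonal_transformation_def t inner_commute)
    have "t $ None = 0"
      using tz[of "axis None 1"] R(2) v(2) by (simp add: inner_axis)
    moreover have "t $ Some i = (transpose B *v x) $ i" for i
    proof -
      have "vcons (0, axis i 1) = axis (Some i) 1"
        by (intro vcons_eqI[symmetric]) (auto simp: axis_def)
      then have "t $ Some i = x \<bullet> (B *v axis i 1)"
        using tz[of "axis (Some i) 1"] TR[of 0 "axis i 1"] by (simp add: inner_axis)
      also have "\<dots> = (transpose B *v x) $ i"
        using dot_lmul_matrix[of x B "axis i 1"] by (simp add: inner_axis transpose_matrix_vector)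
      finally show ?thesis .
    qed
    ultimately have "t = vcons (0, transpose B *v x)" by (intro vcons_eqI) auto
    then have "norm t = norm (transpose B *v x)"
      by (simp add: norm_eq_sqrt_inner inner_vec_def UNIV_option_conv sum.reindex)
    then show ?thesis using t orthogonal_transformation_norm[OF R(1), of t] by simp
  qed
  show ?thesis using 1 2 by blast
qed

lemma distr_normal_density_shift:
  assumes "0 < \<sigma>"
  shows "distr (density lborel (\<lambda>y. ennreal (normal_density m \<sigma> y))) borel (\<lambda>y. y - m) =
    density lborel (\<lambda>y. ennreal (normal_density 0 \<sigma> y))"
proof -
  have "density lborel (\<lambda>y. ennreal (normal_density 0 \<sigma> y)) =
      density (distr lborel borel ((+) (- m))) (\<lambda>y. ennreal (normal_density 0 \<sigma> y))"
    by (simp add: lborel_distr_plus)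
  also have "\<dots> = distr (density lborel (\<lambda>y. ennreal (normal_density 0 \<sigma> (- m + y)))) borel ((+) (- m))"
    by (rule density_distr) auto
  also have "(+) (- m) = (\<lambda>y. y - m)" by auto
  finally show ?thesis by (simp add: normal_density_def)
qed

lemma norm_vcons: "(norm (vcons (u, z)))\<^sup>2 = u\<^sup>2 + (norm z)\<^sup>2"
  unfolding power2_norm_eq_inner
  by (simp add: inner_vec_def UNIV_option_conv sum.reindex power2_eq_square)

text \<open>Stated with an image measure because \<open>B\<close> may be singular, for instance zero
  when \<open>n = 0\<close>. The norm identity records \<open>B B' = \<Sum> a i a i'\<close>, the
  covariance up to the factor \<open>\<sigma>\<^sup>2\<close>.\<close>

lemma distr_normal_sum_eq_gaussI:
  fixes a :: "nat \<Rightarrow> real^'k::finite" and m :: "nat \<Rightarrow> real"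
  assumes \<sigma>: "0 < \<sigma>"
  defines "M \<equiv> \<lambda>i. density lborel (\<lambda>y. ennreal (normal_density (m i) \<sigma> y))"
  shows "\<exists>B :: real^'k^'k.
    distr (PiM {..<n} M) borel (\<lambda>Y. \<Sum>i<n. (Y i - m i) *\<^sub>R a i) = distr (gaussI \<sigma>) borel ((*v) B) \<and>
    (\<forall>x. (norm (transpose B *v x))\<^sup>2 = (\<Sum>i<n. (a i \<bullet> x)\<^sup>2))"
proof (induction n)
  case 0
  interpret G: prob_space "gaussI \<sigma> :: (real^'k) measure" by (rule prob_space_gaussI[OF \<sigma>])
  interpret P: prob_space "PiM {} M" by (rule prob_space_PiM) auto
  have "distr (PiM {} M) borel (\<lambda>Y. 0 :: real^'k) = distr (gaussI \<sigma>) borel (\<lambda>z::real^'k. 0 :: real^'k)"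
    by (subst P.distr_const G.distr_const; simp)+
  moreover have "transpose (0 :: real^'k^'k) = 0" by (simp add: transpose_def vec_eq_iff)
  ultimately show ?case by (intro exI[of _ 0]) auto
next
  case (Suc n)
  then obtain B :: "real^'k^'k"
    where B: "distr (PiM {..<n} M) borel (\<lambda>Y. \<Sum>i<n. (Y i - m i) *\<^sub>R a i) = distr (gaussI \<sigma>) borel ((*v) B)"
      "\<And>x. (norm (transpose B *v x))\<^sup>2 = (\<Sum>i<n. (a i \<bullet> x)\<^sup>2)" by blast
  let ?N = "density lborel (\<lambda>y. ennreal (normal_density 0 \<sigma> y))"
  let ?S = "\<lambda>Y. \<Sum>i<n. (Y i - m i) *\<^sub>R a i" and ?P = "PiM {..<n} M"
  have M_prob: "prob_space (M i)" for i
    unfolding M_def by (rule prob_space_normal_density[OF \<sigma>])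
  have [measurable_cong, simp]: "sets (M i) = sets borel" for i by (simp add: M_def)
  interpret N: prob_space ?N by (rule prob_space_normal_density[OF \<sigma>])
  interpret G: prob_space "gaussI \<sigma> :: (real^'k) measure" by (rule prob_space_gaussI[OF \<sigma>])
  interpret P: prob_space ?P by (rule prob_space_PiM[OF M_prob])
  have [measurable]: "?S \<in> borel_measurable ?P" by measurable
  have [measurable]: "(*v) B \<in> borel_measurable borel"
    by (intro borel_measurable_continuous_onI continuous_intros)
  interpret GB: prob_space "distr (gaussI \<sigma>) borel ((*v) B)" by (rule G.prob_space_distr) simp
  \<comment> \<open>\<open>T\<close> has the new column \<open>a n\<close> next to the columns of
    \<open>B\<close>; \<open>distr_gaussI_reduce\<close> makes it square again.\<close>
  define T where "T y = (y $ None) *\<^sub>R a n + B *v (\<chi> i. y $ Some i)" for y :: "real^('k option)"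
  have T: "linear T"
    unfolding T_def
    by (rule linearI) (auto simp: vec_eq_iff matrix_vector_mult_def algebra_simps sum.distrib sum_distrib_left)
  have [measurable]: "T \<in> borel_measurable borel"
    using T by (auto intro!: borel_measurable_continuous_onI linear_continuous_on simp: linear_conv_bounded_linear)
  have "distr (PiM {..<Suc n} M) borel (\<lambda>Y. \<Sum>i<Suc n. (Y i - m i) *\<^sub>R a i) =
      distr (distr (M n \<Otimes>\<^sub>M ?P) (PiM (insert n {..<n}) M) (\<lambda>(y, Y). Y(n := y))) borel
        (\<lambda>Y. \<Sum>i<Suc n. (Y i - m i) *\<^sub>R a i)"
    by (subst distr_pair_PiM_eq_PiM) (auto simp: M_prob lessThan_Suc)
  also have "\<dots> = distr (M n \<Otimes>\<^sub>M ?P) borel (\<lambda>(y, Y). (y - m n) *\<^sub>R a n + ?S Y)"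
    by (subst distr_distr) (auto simp: o_def case_prod_unfold lessThan_Suc intro!: distr_cong)
  also have "\<dots> = distr (distr (M n \<Otimes>\<^sub>M ?P) (borel \<Otimes>\<^sub>M borel) (\<lambda>(y, Y). (y - m n, ?S Y))) borel
      (\<lambda>(u, s). u *\<^sub>R a n + s)"
    by (subst distr_distr) (auto simp: o_def case_prod_unfold)
  also have "distr (M n \<Otimes>\<^sub>M ?P) (borel \<Otimes>\<^sub>M borel) (\<lambda>(y, Y). (y - m n, ?S Y)) =
      distr (M n) borel (\<lambda>y. y - m n) \<Otimes>\<^sub>M distr ?P borel ?S"
    by (rule pair_measure_distr[symmetric]) (auto simp: B(1) GB.sigma_finite_measure_axioms)
  \<comment> \<open>The trivial image is written out so that the product of the two laws matches
    \<open>pair_measure_distr\<close>.\<close>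
  also have "distr (M n) borel (\<lambda>y. y - m n) = distr ?N borel (\<lambda>y. y)"
    unfolding M_def by (subst distr_normal_density_shift[OF \<sigma>], subst distr_id2) auto
  also have "distr ?N borel (\<lambda>y. y) \<Otimes>\<^sub>M distr ?P borel ?S =
      distr (?N \<Otimes>\<^sub>M gaussI \<sigma>) (borel \<Otimes>\<^sub>M borel) (\<lambda>(u, z). (u, B *v z))"
    unfolding B(1) by (rule pair_measure_distr) (auto simp: GB.sigma_finite_measure_axioms)
  also have "distr (distr (?N \<Otimes>\<^sub>M gaussI \<sigma>) (borel \<Otimes>\<^sub>M borel) (\<lambda>(u, z). (u, B *v z))) borel
      (\<lambda>(u, s). u *\<^sub>R a n + s) = distr (?N \<Otimes>\<^sub>M gaussI \<sigma>) borel (\<lambda>x. T (vcons x))"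
    by (subst distr_distr) (auto simp: o_def case_prod_unfold T_def vcons_def intro!: distr_cong)
  also have "\<dots> = distr (distr (?N \<Otimes>\<^sub>M gaussI \<sigma>) borel vcons) borel T"
    by (subst distr_distr) (auto simp: o_def)
  also have "\<dots> = distr (gaussI \<sigma>) borel T"
    by (simp add: distr_gaussI_vcons[OF \<sigma>])
  finally have law: "distr (PiM {..<Suc n} M) borel (\<lambda>Y. \<Sum>i<Suc n. (Y i - m i) *\<^sub>R a i) = distr (gaussI \<sigma>) borel T" .
  have "adjoint T = (\<lambda>x. vcons (a n \<bullet> x, transpose B *v x))"
  proof (rule adjoint_unique, intro allI)
    fix y x
    have "(B *v z) \<bullet> x = z \<bullet> (transpose B *v x)" for z
      using dot_lmul_matrix[of x B z] by (simp add: transpose_matrix_vector inner_commute)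
    then show "T y \<bullet> x = y \<bullet> vcons (a n \<bullet> x, transpose B *v x)"
      by (simp add: T_def inner_add_left inner_vec_def[of y] UNIV_option_conv sum.reindex)
         (simp add: inner_vec_def)
  qed
  then have norm_adj: "(norm (adjoint T x))\<^sup>2 = (\<Sum>i<Suc n. (a i \<bullet> x)\<^sup>2)" for x
    using B(2)[of x] by (simp add: norm_vcons)
  from distr_gaussI_reduce[OF \<sigma> T] obtain B' :: "real^'k^'k"
    where "distr (gaussI \<sigma>) borel T = distr (gaussI \<sigma>) borel ((*v) B')"
      "\<forall>x. norm (transpose B' *v x) = norm (adjoint T x)" by blast
  then show ?case using law norm_adj by (intro exI[of _ B']) simp
qed

lemma symmetric_quadratic_eq:
  fixes M N :: "real^'n^'n"
  assumes M: "transpose M = M" and N: "transpose N = N" and eq: "\<And>x. x \<bullet> (M *v x) = x \<bullet> (N *v x)"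
  shows "M = N"
proof -
  have sym: "y \<bullet> (A *v x) = x \<bullet> (A *v y)" if "transpose A = A" for A :: "real^'n^'n" and x y
    using dot_lmul_matrix[of y A x] that
    by (metis inner_commute transpose_matrix_vector)
  have "x \<bullet> (M *v y) = x \<bullet> (N *v y)" for x y
    using eq[of "x + y"] eq[of x] eq[of y] sym[OF M, of x y] sym[OF N, of x y]
    by (simp add: matrix_vector_right_distrib inner_add_left inner_add_right)
  then have "M *v y = N *v y" for y
    by (subst vector_eq_ldot[symmetric]) simp
  then show ?thesis by (simp add: matrix_eq)
qed

text \<open>By polarisation the norm identity means \<open>B B' = P\<close>, so \<open>B' A\<close>
  is a right inverse of \<open>B\<close>. For square matrices it is then a left inverse,
  \<open>B' A B = I\<close>: exactly the whitening condition of
  \<open>distr_gaussI_linear\<close>.\<close>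

lemma quadratic_form_of_factor:
  fixes A B P :: "real^'n^'n"
  assumes P: "transpose P = P" and PA: "P ** A = mat 1" and eq: "\<And>x. (norm (transpose B *v x))\<^sup>2 = x \<bullet> (P *v x)"
  shows "(B *v z) \<bullet> (A *v (B *v z)) = z \<bullet> z"
proof -
  have tr: "x \<bullet> (B *v w) = (transpose B *v x) \<bullet> w" for x w
    using dot_lmul_matrix[of x B w] by (simp add: transpose_matrix_vector)
  have "B ** transpose B = P"
  proof (rule symmetric_quadratic_eq)
    show "x \<bullet> (B ** transpose B *v x) = x \<bullet> (P *v x)" for x
      using eq[of x] tr[of x "transpose B *v x"]
      by (simp add: power2_norm_eq_inner flip: matrix_vector_mul_assoc)
  qed (use P in \<open>simp_all add: matrix_transpose_mul\<close>)
  then have "B ** (transpose B ** A) = mat 1" using PA by (simp add: matrix_mul_assoc)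
  then have "(transpose B ** A) ** B = mat 1" using matrix_left_right_inverse by blast
  then have "z \<bullet> ((transpose B ** A ** B) *v z) = z \<bullet> z" by simp
  moreover have "z \<bullet> ((transpose B ** A ** B) *v z) = (B *v z) \<bullet> (A *v (B *v z))"
    using tr[of "A *v (B *v z)" z] by (simp add: inner_commute flip: matrix_vector_mul_assoc)
  ultimately show ?thesis by simp
qed

section \<open>The exact law of the unrestricted estimator\<close>

lemma gram_mult_vec: "gram X n *v b = (\<Sum>i<n. (\<Sum>j\<in>UNIV. X n i j * b $ j) *\<^sub>R (\<chi> j. X n i j))"
  by (simp add: vec_eq_iff gram_def matrix_vector_mult_def sum_distrib_right sum_distrib_left sum.swap[of _ UNIV] mult_ac)

lemma gram_quadratic: "b \<bullet> (gram X n *v b) = (\<Sum>i<n. (\<Sum>j\<in>UNIV. X n i j * b $ j)\<^sup>2)"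
proof -
  have "b \<bullet> (\<chi> j. X n i j) = (\<Sum>j\<in>UNIV. X n i j * b $ j)" for i
    by (simp add: inner_vec_def mult.commute)
  then show ?thesis
    by (simp only: gram_mult_vec inner_sum_right inner_scaleR_right power2_eq_square)
qed

lemma pos_def_gram:
  assumes "full_col_rank X n" shows "pos_def (gram X n)"
  unfolding pos_def_def
proof (intro conjI allI impI)
  show "transpose (gram X n) = gram X n"
    by (simp add: transpose_def gram_def vec_eq_iff mult.commute)
  fix b :: "real^'a" assume "b \<noteq> 0"
  then obtain i where i: "i < n" "(\<Sum>j\<in>UNIV. X n i j * b $ j) \<noteq> 0"
    using assms by (auto simp: full_col_rank_def)
  then show "0 < b \<bullet> (gram X n *v b)"
    unfolding gram_quadratic by (intro sum_pos2[of _ i]) auto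
qed

lemma pos_def_scale: "pos_def A \<Longrightarrow> 0 < c \<Longrightarrow> pos_def (c *\<^sub>R A)"
  by (auto intro!: pos_defI simp: pos_def_sym pos_def_pos scaleR_matrix_vector_assoc[symmetric])

lemma matrix_inv_scaleR:
  fixes A :: "real^'n^'n"
  assumes "invertible A" "c \<noteq> 0"
  shows "matrix_inv (c *\<^sub>R A) = (1 / c) *\<^sub>R matrix_inv A"
  using assms by (intro matrix_inv_unique_real)
    (simp add: matrix_eq scaleR_matrix_vector_assoc[symmetric] matrix_vector_mult_scaleR
      matrix_inv_mul_vec flip: matrix_vector_mul_assoc)

lemma betaU_eq_sum: "betaU X n Y = (\<Sum>i<n. Y i *\<^sub>R (matrix_inv (gram X n) *v (\<chi> j. X n i j)))"
proof -
  have "(\<chi> j. \<Sum>i<n. X n i j * Y i) = (\<Sum>i<n. Y i *\<^sub>R (\<chi> j. X n i j))"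
    by (simp add: vec_eq_iff mult.commute)
  then show ?thesis
    by (simp add: betaU_def linear_sum[OF matrix_vector_mul_linear] matrix_vector_mult_scaleR)
qed

lemma sets_PY [measurable_cong]: "sets (PY X n \<beta> \<sigma>) = sets (PiM {..<n} (\<lambda>_. borel))"
  unfolding PY_def by (rule sets_PiM_cong) auto

lemma measurable_betaU [measurable]: "betaU X n \<in> borel_measurable (PY X n \<beta> \<sigma>)"
  unfolding betaU_eq_sum[abs_def] by measurable

text \<open>The scaled error is \<open>\<Sum> (Y i - m i) a i\<close> with
  \<open>a i = sqrt n G^-1 x i\<close>, where \<open>x i\<close> is row \<open>i\<close> of the
  design. Summing \<open>(a i \<bullet> y)\<^sup>2\<close> gives \<open>n\<close> times the form of
  \<open>G^-1\<close> at \<open>y\<close>, which is the form of the inverse of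
  \<open>G / n\<close>.\<close>

lemma distr_betaU:
  fixes X :: "nat \<Rightarrow> nat \<Rightarrow> 'k::finite \<Rightarrow> real"
  assumes \<sigma>: "0 < \<sigma>" and n: "0 < n" and rank: "full_col_rank X n"
  shows "distr (PY X n \<beta> \<sigma>) borel (\<lambda>Y. sqrt (real n) *\<^sub>R (betaU X n Y - \<beta>)) =
    density lborel (\<lambda>v. ennreal (gdens \<sigma> ((1 / real n) *\<^sub>R gram X n) v))"
proof -
  let ?G = "gram X n" and ?A = "(1 / real n) *\<^sub>R gram X n"
  have G: "pos_def ?G" by (rule pos_def_gram[OF rank])
  note Gi = pos_def_invertible[OF G]
  have A: "pos_def ?A" using G n by (intro pos_def_scale) auto
  define x where "x i = (\<chi> j. X n i j)" for i
  define m where "m i = (\<Sum>j\<in>UNIV. X n i j * \<beta> $ j)" for i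
  define a where "a i = sqrt (real n) *\<^sub>R (matrix_inv ?G *v x i)" for i
  have eq: "sqrt (real n) *\<^sub>R (betaU X n Y - \<beta>) = (\<Sum>i<n. (Y i - m i) *\<^sub>R a i)" for Y
  proof -
    have "\<beta> = matrix_inv ?G *v (?G *v \<beta>)" using matrix_inv_mul_vec[OF Gi] by simp
    also have "\<dots> = (\<Sum>i<n. m i *\<^sub>R (matrix_inv ?G *v x i))"
      by (simp add: gram_mult_vec m_def x_def linear_sum[OF matrix_vector_mul_linear] matrix_vector_mult_scaleR)
    finally have "betaU X n Y - \<beta> = (\<Sum>i<n. (Y i - m i) *\<^sub>R (matrix_inv ?G *v x i))"
      by (simp add: betaU_eq_sum x_def sum_subtractf scaleR_diff_left)
    then show ?thesis
      by (simp add: scaleR_sum_right a_def mult.commute)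
  qed
  obtain B :: "real^'k^'k" where B: "distr (PY X n \<beta> \<sigma>) borel (\<lambda>Y. \<Sum>i<n. (Y i - m i) *\<^sub>R a i) =
      distr (gaussI \<sigma>) borel ((*v) B)"
    "\<And>x. (norm (transpose B *v x))\<^sup>2 = (\<Sum>i<n. (a i \<bullet> x)\<^sup>2)"
    using distr_normal_sum_eq_gaussI[OF \<sigma>, where n = n and a = a and m = m] unfolding PY_def m_def by blast
  have "(\<Sum>i<n. (a i \<bullet> y)\<^sup>2) = y \<bullet> (matrix_inv ?A *v y)" for y
  proof -
    let ?y = "matrix_inv ?G *v y"
    have "a i \<bullet> y = sqrt (real n) * (\<Sum>j\<in>UNIV. X n i j * ?y $ j)" for i
      by (simp add: a_def pos_def_inv_sym[OF G]) (simp add: inner_vec_def x_def)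
    then have "(\<Sum>i<n. (a i \<bullet> y)\<^sup>2) = real n * (?y \<bullet> (?G *v ?y))"
      by (simp add: gram_quadratic power_mult_distrib flip: sum_distrib_left)
    also have "\<dots> = y \<bullet> (matrix_inv ?A *v y)"
      using n matrix_inv_mul_vec[OF Gi]
      by (simp add: matrix_inv_scaleR[OF Gi] scaleR_matrix_vector_assoc[symmetric] inner_commute)
    finally show ?thesis .
  qed
  then have "(norm (transpose B *v y))\<^sup>2 = y \<bullet> (matrix_inv ?A *v y)" for y
    by (simp only: B(2))
  then have "(B *v z) \<bullet> (?A *v (B *v z)) = z \<bullet> z" for z
    using matrix_inv_mul[OF pos_def_invertible[OF A]] pos_def_matrix_inv[OF A]
    by (intro quadratic_form_of_factor[of "matrix_inv ?A"]) (simp_all only: pos_def_def)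
  from distr_gaussI_linear[OF \<sigma> A matrix_vector_mul_linear this]
  show ?thesis by (simp add: eq B(1))
qed

section \<open>Weak convergence of the averaged estimator\<close>

text \<open>The same function serves the finite sample, with \<open>A = X'X/n\<close> and
  \<open>g = sqrt n \<beta>\<^sub>2\<close>, and the limit, with \<open>Q\<close> and
  \<open>\<gamma>\<close>, so convergence becomes continuity in the parameters.\<close>

definition avg_map :: "real \<Rightarrow> real \<Rightarrow> real^('a::finite + 'b::finite)^('a + 'b) \<Rightarrow> real^'b \<Rightarrow> real^('a + 'b) \<Rightarrow> real^('a + 'b)" where
  "avg_map \<alpha> \<sigma> A g v = (let x = vsnd v + g in
     v + (1 / (1 + exp (- 2 * \<alpha> * real CARD('b)) * exp (\<alpha> * (x \<bullet> (schur A *v x)) / \<sigma>\<^sup>2))) *\<^sub>R vjoin (regr A x) (- x))"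

lemma blk11_scaleR: "blk11 (c *\<^sub>R Q) = c *\<^sub>R blk11 Q"
  and blk12_scaleR: "blk12 (c *\<^sub>R Q) = c *\<^sub>R blk12 Q"
  and blk21_scaleR: "blk21 (c *\<^sub>R Q) = c *\<^sub>R blk21 Q"
  and blk22_scaleR: "blk22 (c *\<^sub>R Q) = c *\<^sub>R blk22 Q"
  by (simp_all add: blk11_def blk12_def blk21_def blk22_def vec_eq_iff)

lemma regr_scaleR:
  assumes "pos_def Q" "c \<noteq> 0" shows "regr (c *\<^sub>R Q) v = regr Q v"
  using assms matrix_inv_scaleR[OF pos_def_invertible[OF pos_def_blk11[OF assms(1)]]]
  by (simp add: regr_def blk11_scaleR blk12_scaleR matrix_vector_mult_scaleR flip: scaleR_matrix_vector_assoc)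

lemma schur_scaleR_mult:
  assumes "pos_def Q" "c \<noteq> 0" shows "schur (c *\<^sub>R Q) *v v = c *\<^sub>R (schur Q *v v)"
  by (simp add: schur_mult regr_scaleR[OF assms] blk22_scaleR blk21_scaleR scaleR_diff_right
      flip: scaleR_matrix_vector_assoc)

text \<open>The first square of the completed form vanishes at this vector. Limits and lower bounds
  for \<open>A\<close> thereby carry over to the Schur form.\<close>

lemma schur_quadratic:
  assumes "pos_def Q"
  shows "x \<bullet> (schur Q *v x) = vjoin (regr Q x) (- x) \<bullet> (Q *v vjoin (regr Q x) (- x))"
  by (simp add: quadratic_form_complete_square[OF assms] linear_neg[OF linear_regr]
      linear_neg[OF matrix_vector_mul_linear])

text \<open>\<open>X'Y\<close> is \<open>gram X n\<close> applied to \<open>betaU\<close>;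
  multiplying its first block by the inverse of \<open>blk11\<close> expresses the restricted fit
  through \<open>betaU\<close> alone.\<close>

lemma betaR_eq:
  fixes X :: "nat \<Rightarrow> nat \<Rightarrow> ('a::finite + 'b::finite) \<Rightarrow> real"
  assumes G: "pos_def (gram X n)"
  shows "betaR X n Y = betaU X n Y + vjoin (regr (gram X n) (vsnd (betaU X n Y))) (- vsnd (betaU X n Y))"
proof -
  let ?G = "gram X n" and ?b = "betaU X n Y"
  have "?G *v ?b = (\<chi> j. \<Sum>i<n. X n i j * Y i)"
    unfolding betaU_def by (rule matrix_inv_mul_vec[OF pos_def_invertible[OF G]])
  then have "(\<chi> j. \<Sum>i<n. X n i (Inl j) * Y i) = vfst (?G *v ?b)"
    by (simp add: vec_eq_iff)
  also have "\<dots> = blk11 ?G *v vfst ?b + blk12 ?G *v vsnd ?b"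
    by (simp add: matrix_vector_mult_blocks)
  finally have "matrix_inv (blk11 ?G) *v (\<chi> j. \<Sum>i<n. X n i (Inl j) * Y i) = vfst ?b + regr ?G (vsnd ?b)"
    using matrix_inv_mul_vec[OF pos_def_invertible[OF pos_def_blk11[OF G]]]
    by (simp add: matrix_vector_right_distrib regr_def)
  then show ?thesis
    by (simp add: betaR_def vec_sum_eq_iff)
qed

text \<open>The loss \<open>d2\<close> is the Gram form at \<open>betaR - betaU\<close>, hence the
  Schur form at the second block of \<open>betaU\<close>. The scaling cancels: dividing the Gram
  matrix by \<open>n\<close> compensates the factor \<open>sqrt n\<close> in \<open>x\<close>, and
  \<open>regr\<close> is scale invariant.\<close>

lemma betaTilde_eq_avg_map:
  fixes X :: "nat \<Rightarrow> nat \<Rightarrow> ('a::finite + 'b::finite) \<Rightarrow> real"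
  assumes n: "0 < n" and rank: "full_col_rank X n"
  shows "sqrt (real n) *\<^sub>R (betaTilde \<alpha> \<sigma> X n Y - \<beta>) =
    avg_map \<alpha> \<sigma> ((1 / real n) *\<^sub>R gram X n) (sqrt (real n) *\<^sub>R vsnd \<beta>) (sqrt (real n) *\<^sub>R (betaU X n Y - \<beta>))"
proof -
  let ?G = "gram X n" and ?b = "betaU X n Y" and ?s = "sqrt (real n)"
  have G: "pos_def ?G" by (rule pos_def_gram[OF rank])
  define d where "d = vjoin (regr ?G (vsnd ?b)) (- vsnd ?b)"
  have bR: "betaR X n Y = ?b + d" unfolding d_def by (rule betaR_eq[OF G])
  define x where "x = vsnd (?s *\<^sub>R (?b - \<beta>)) + ?s *\<^sub>R vsnd \<beta>"
  have x: "x = ?s *\<^sub>R vsnd ?b" by (simp add: x_def algebra_simps)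
  define l where "l = 1 / (1 + exp (- 2 * \<alpha> * real CARD('b)) * exp (\<alpha> * (x \<bullet> (schur ((1 / real n) *\<^sub>R ?G) *v x)) / \<sigma>\<^sup>2))"
  have "(\<Sum>i<n. (\<Sum>j\<in>UNIV. X n i j * (betaR X n Y $ j - ?b $ j))\<^sup>2) = d \<bullet> (?G *v d)"
    by (simp add: gram_quadratic bR)
  also have "\<dots> = vsnd ?b \<bullet> (schur ?G *v vsnd ?b)"
    unfolding d_def by (rule schur_quadratic[OF G, symmetric])
  also have "\<dots> = x \<bullet> (schur ((1 / real n) *\<^sub>R ?G) *v x)"
    using n by (simp add: schur_scaleR_mult[OF G] x matrix_vector_mult_scaleR flip: mult.assoc)
  finally have "betaTilde \<alpha> \<sigma> X n Y = l *\<^sub>R betaR X n Y + (1 - l) *\<^sub>R ?b"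
    by (simp add: betaTilde_def Let_def l_def)
  then have "?s *\<^sub>R (betaTilde \<alpha> \<sigma> X n Y - \<beta>) = ?s *\<^sub>R (?b - \<beta>) + l *\<^sub>R (?s *\<^sub>R d)"
    by (simp add: bR algebra_simps)
  moreover have "?s *\<^sub>R d = vjoin (regr ((1 / real n) *\<^sub>R ?G) x) (- x)"
    using n by (simp add: d_def x vec_sum_eq_iff regr_scaleR[OF G] linear_scale[OF linear_regr])
  ultimately show ?thesis
    by (simp only: avg_map_def Let_def x_def[symmetric] l_def[symmetric])
qed

section \<open>Continuity and pointwise limits of the averaging map\<close>

lemma continuous_avg_map: "continuous_on UNIV (avg_map \<alpha> \<sigma> A g)"
proof -
  have c: "continuous_on UNIV f" if "linear f" for f :: "real^'n::finite \<Rightarrow> real^'m::finite"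
    using that by (simp add: linear_continuous_on linear_conv_bounded_linear)
  have vs: "continuous_on UNIV (\<lambda>v. vsnd v + g)"
    by (intro continuous_intros c linear_vsnd)
  have vj: "continuous_on UNIV (\<lambda>v. vjoin (regr A (vsnd v + g)) (- (vsnd v + g)))"
    by (rule continuous_on_compose2[OF c[OF linear_vjoin[OF linear_regr linear_uminus]] vs]) auto
  have q: "continuous_on UNIV (\<lambda>v. (vsnd v + g) \<bullet> (schur A *v (vsnd v + g)))"
    by (rule continuous_on_inner[OF vs continuous_on_compose2[OF c[OF matrix_vector_mul_linear] vs]]) auto
  have pos: "1 + exp a * exp b \<noteq> 0" for a b :: real
    by (metis add_pos_pos exp_gt_zero less_irrefl mult_pos_pos zero_less_one)
  show ?thesis
    unfolding avg_map_def Let_def divide_inverse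
    by (intro continuous_on_add continuous_on_id continuous_on_scaleR vj continuous_on_mult continuous_on_const
        continuous_on_inverse continuous_on_exp q ballI pos)
qed

lemma measurable_avg_map [measurable]: "avg_map \<alpha> \<sigma> A g \<in> borel_measurable borel"
  by (intro borel_measurable_continuous_onI continuous_avg_map)

lemma norm_le_vjoin: "(norm b)\<^sup>2 \<le> (norm (vjoin a (- b)))\<^sup>2"
  by (simp only: power2_norm_eq_inner inner_vec_sum vfst_vjoin vsnd_vjoin inner_minus_left inner_minus_right) simp

lemma tendsto_vjoin:
  assumes "(f \<longlongrightarrow> a) F" "(g \<longlongrightarrow> b) F"
  shows "((\<lambda>x. vjoin (f x) (g x)) \<longlongrightarrow> vjoin a b) F"
  unfolding vjoin_def
  by (intro tendsto_vec_lambda) (auto split: sum.split intro!: tendsto_vec_nth assms)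

lemma tendsto_blocks:
  assumes "(A \<longlongrightarrow> Q) F"
  shows "((\<lambda>n. blk11 (A n)) \<longlongrightarrow> blk11 Q) F" "((\<lambda>n. blk12 (A n)) \<longlongrightarrow> blk12 Q) F"
  unfolding blk11_def blk12_def
  by (intro tendsto_vec_lambda tendsto_vec_nth assms)+

lemma tendsto_regr:
  assumes A: "A \<longlonglongrightarrow> Q" and Q: "pos_def Q" and pd: "\<forall>\<^sub>F n in sequentially. pos_def (A n)" and x: "x \<longlonglongrightarrow> y"
  shows "(\<lambda>n. regr (A n) (x n)) \<longlonglongrightarrow> regr Q y"
  unfolding regr_def
  by (intro tendsto_matrix_inv_vec tendsto_matrix_vector_mult tendsto_blocks A x pos_def_blk11 Q
      eventually_mono[OF pd])

lemma tendsto_avg_map: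
  assumes A: "A \<longlonglongrightarrow> Q" and Q: "pos_def Q" and pd: "\<forall>\<^sub>F n in sequentially. pos_def (A n)" and g: "g \<longlonglongrightarrow> \<gamma>"
  shows "(\<lambda>n. avg_map \<alpha> \<sigma> (A n) (g n) v) \<longlonglongrightarrow> avg_map \<alpha> \<sigma> Q \<gamma> v"
proof -
  let ?x = "\<lambda>n. vsnd v + g n" and ?y = "vsnd v + \<gamma>"
  have x: "?x \<longlonglongrightarrow> ?y" by (intro tendsto_add tendsto_const g)
  have d: "(\<lambda>n. vjoin (regr (A n) (?x n)) (- ?x n)) \<longlonglongrightarrow> vjoin (regr Q ?y) (- ?y)"
    by (intro tendsto_vjoin tendsto_regr tendsto_minus A Q pd x)
  have "(\<lambda>n. vjoin (regr (A n) (?x n)) (- ?x n) \<bullet> (A n *v vjoin (regr (A n) (?x n)) (- ?x n)))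
      \<longlonglongrightarrow> vjoin (regr Q ?y) (- ?y) \<bullet> (Q *v vjoin (regr Q ?y) (- ?y))"
    by (intro tendsto_inner tendsto_matrix_vector_mult d A)
  then have q: "(\<lambda>n. ?x n \<bullet> (schur (A n) *v ?x n)) \<longlonglongrightarrow> ?y \<bullet> (schur Q *v ?y)"
    unfolding schur_quadratic[OF Q]
    by (rule Lim_transform_eventually) (use pd in eventually_elim, simp add: schur_quadratic)
  have pos: "1 + exp a * exp b \<noteq> 0" for a b :: real
    by (metis add_pos_pos exp_gt_zero less_irrefl mult_pos_pos zero_less_one)
  show ?thesis
    unfolding avg_map_def Let_def divide_inverse
    by (intro tendsto_add tendsto_const tendsto_scaleR d tendsto_mult tendsto_inverse tendsto_exp q pos)
qed

lemma tendsto_avg_map_at_infinity: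
  assumes A: "A \<longlonglongrightarrow> Q" and Q: "pos_def Q" and pd: "\<forall>\<^sub>F n in sequentially. pos_def (A n)"
    and g: "filterlim (\<lambda>n. norm (g n)) at_top sequentially" and \<alpha>: "0 < \<alpha>" and \<sigma>: "0 < \<sigma>"
  shows "(\<lambda>n. avg_map \<alpha> \<sigma> (A n) (g n) (v :: real^('a::finite + 'b::finite))) \<longlonglongrightarrow> v"
proof -
  obtain c where c: "0 < c" and lb: "\<forall>\<^sub>F n in sequentially. \<forall>x. c * (norm x)\<^sup>2 \<le> x \<bullet> (A n *v x)"
    using pos_def_eventually_lower_bound[OF A Q] by blast
  let ?x = "\<lambda>n. vsnd v + g n"
  let ?q = "\<lambda>n. ?x n \<bullet> (schur (A n) *v ?x n)"
  let ?d = "\<lambda>n. vjoin (regr (A n) (?x n)) (- ?x n)"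
  define k where "k = exp (- 2 * \<alpha> * real CARD('b))"
  have k: "0 < k" by (simp add: k_def)
  \<comment> \<open>By the reverse triangle inequality this is a lower bound for
    \<open>norm (?x n)\<close>, as \<open>v\<close> stays fixed.\<close>
  have "filterlim (\<lambda>n. - norm (vsnd v) + norm (g n)) at_top sequentially"
    by (rule filterlim_tendsto_add_at_top[OF tendsto_const g])
  then have x: "filterlim (\<lambda>n. norm (?x n)) at_top sequentially"
    by (rule filterlim_at_top_mono) (auto intro!: always_eventually, smt (verit) norm_diff_ineq add.commute)
  have dq: "\<forall>\<^sub>F n in sequentially. c * (norm (?d n))\<^sup>2 \<le> ?q n"
    using lb pd by eventually_elim (simp add: schur_quadratic)
  have "filterlim (\<lambda>n. c * (norm (?x n))\<^sup>2) at_top sequentially"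
    using c by (intro filterlim_tendsto_pos_mult_at_top[OF tendsto_const] filterlim_pow_at_top x) auto
  \<comment> \<open>\<open>?q n\<close> is at least \<open>c\<close> times the squared norm of
    \<open>?d n\<close>, whose second block is \<open>- ?x n\<close>.\<close>
  then have q: "filterlim ?q at_top sequentially"
  proof (rule filterlim_at_top_mono)
    show "\<forall>\<^sub>F n in sequentially. c * (norm (?x n))\<^sup>2 \<le> ?q n"
      using dq
    proof eventually_elim
      case (elim n)
      have "(norm (?x n))\<^sup>2 \<le> (norm (?d n))\<^sup>2"
        by (rule norm_le_vjoin)
      then have "c * (norm (?x n))\<^sup>2 \<le> c * (norm (?d n))\<^sup>2" using c by simp
      with elim show ?case by linarith
    qed
  qed
  have "((\<lambda>t. sqrt (t / c) / (k * exp (\<alpha> * t / \<sigma>\<^sup>2))) \<longlongrightarrow> 0) at_top"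
    using c k \<alpha> \<sigma> by real_asymp
  from filterlim_compose[OF this q]
  have lim: "(\<lambda>n. sqrt (?q n / c) / (k * exp (\<alpha> * ?q n / \<sigma>\<^sup>2))) \<longlonglongrightarrow> 0" .
  have "\<forall>\<^sub>F n in sequentially. norm (avg_map \<alpha> \<sigma> (A n) (g n) v - v) \<le> sqrt (?q n / c) / (k * exp (\<alpha> * ?q n / \<sigma>\<^sup>2))"
    using dq
  proof eventually_elim
    case (elim n)
    let ?e = "k * exp (\<alpha> * ?q n / \<sigma>\<^sup>2)"
    have e: "0 < ?e" using k by simp
    have "norm (avg_map \<alpha> \<sigma> (A n) (g n) v - v) = norm (?d n) / (1 + ?e)"
      using e by (simp add: avg_map_def Let_def k_def)
    also have "\<dots> \<le> sqrt (?q n / c) / ?e"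
    proof (rule frac_le)
      show "norm (?d n) \<le> sqrt (?q n / c)"
        using elim c by (intro real_le_rsqrt) (simp add: field_simps)
    qed (use e elim c in \<open>auto intro!: divide_nonneg_pos order_trans[OF _ elim]\<close>)
    finally show ?case .
  qed
  from Lim_null_comparison[OF this lim] show ?thesis by (rule LIM_zero_cancel)
qed

section \<open>Dominated convergence for Gaussian densities\<close>

lemma gdens_nonneg: "0 \<le> det Q \<Longrightarrow> 0 \<le> gdens \<sigma> Q v"
  by (simp add: gdens_def)

text \<open>\<open>whiten Q\<close> supplies a real square whose product with \<open>det Q\<close>
  is one; this construction is why the index type is a sum.\<close>

lemma pos_def_det_pos:
  assumes "pos_def (Q :: real^('a::finite + 'b::finite)^('a + 'b))" shows "0 < det Q"
  using det_whitening_map[OF assms linear_whiten whiten_quadratic[OF assms]]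
  by (metis not_less zero_le_power2 mult_nonneg_nonpos not_one_le_zero)

lemma integrable_exp_neg_norm_sq:
  assumes "0 < c" shows "integrable lborel (\<lambda>v::real^'n. exp (- c * (norm v)\<^sup>2))"
proof -
  \<comment> \<open>Chosen so that \<open>1 / (2 * s\<^sup>2) = c\<close>: the integrand is a
    multiple of the density of \<open>N(0, s\<^sup>2 I)\<close>.\<close>
  define s where "s = sqrt (1 / (2 * c))"
  have s: "0 < s" "2 * s\<^sup>2 = 1 / c" using assms by (simp_all add: s_def)
  let ?k = "(2 * pi * s\<^sup>2) powr (- real CARD('n) / 2)"
  have k: "?k \<noteq> 0" using s by simp
  have "gdens s (mat 1) v = ?k * exp (- c * (norm v)\<^sup>2)" for v :: "real^'n"
    by (simp add: gdens_def s(2) power2_norm_eq_inner mult.commute)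
  then have "(\<lambda>v::real^'n. exp (- c * (norm v)\<^sup>2)) = (\<lambda>v. gdens s (mat 1) v / ?k)"
    using k by (auto simp: fun_eq_iff)
  then show ?thesis using integrable_gdens_mat_1[OF s(1), where 'n = 'n] by (simp only: integrable_divide)
qed

lemma tendsto_gdens:
  assumes A: "A \<longlonglongrightarrow> Q" and \<sigma>: "0 < \<sigma>"
  shows "(\<lambda>n. gdens \<sigma> (A n) v) \<longlonglongrightarrow> gdens \<sigma> Q v"
  unfolding gdens_def using \<sigma>
  by (intro tendsto_mult tendsto_const tendsto_real_sqrt tendsto_det A tendsto_exp tendsto_divide tendsto_minus
      tendsto_inner tendsto_matrix_vector_mult) auto

text \<open>A continuous mapping theorem in which laws and maps vary together. The bound
  \<open>M\<close> on \<open>f\<close>, the eventual bound \<open>det Q + 1\<close> on the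
  determinants and the uniform constant \<open>c\<close> combine into one integrable Gaussian
  majorant.\<close>

lemma tendsto_integral_gdens:
  fixes A :: "nat \<Rightarrow> real^('a::finite + 'b::finite)^('a + 'b)" and f :: "real^'m::finite \<Rightarrow> real"
  assumes A: "A \<longlonglongrightarrow> Q" and Q: "pos_def Q" and \<sigma>: "0 < \<sigma>"
    and F: "\<And>v. (\<lambda>n. F n v) \<longlonglongrightarrow> G v"
    and [measurable]: "\<And>n. F n \<in> borel_measurable borel" "G \<in> borel_measurable borel"
    and f: "continuous_on UNIV f" "bounded (range f)"
  shows "(\<lambda>n. integral\<^sup>L (density lborel (\<lambda>v. ennreal (gdens \<sigma> (A n) v))) (\<lambda>v. f (F n v)))
    \<longlonglongrightarrow> integral\<^sup>L (density lborel (\<lambda>v. ennreal (gdens \<sigma> Q v))) (\<lambda>v. f (G v))"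
proof -
  have [measurable]: "f \<in> borel_measurable borel" using f(1) by (rule borel_measurable_continuous_onI)
  obtain M where M: "\<And>x. \<bar>f x\<bar> \<le> M" using f(2) by (auto simp: bounded_iff)
  have detQ: "0 < det Q" by (rule pos_def_det_pos[OF Q])
  obtain c where c: "0 < c" and lb: "\<forall>\<^sub>F n in sequentially. \<forall>x. c * (norm x)\<^sup>2 \<le> x \<bullet> (A n *v x)"
    using pos_def_eventually_lower_bound[OF A Q] by blast
  have det: "(\<lambda>n. det (A n)) \<longlonglongrightarrow> det Q" by (rule tendsto_det[OF A])
  have "\<forall>\<^sub>F n in sequentially. 0 < det (A n)" "\<forall>\<^sub>F n in sequentially. det (A n) < det Q + 1"
    using order_tendstoD[OF det] detQ by auto
  with lb have "\<forall>\<^sub>F n in sequentially. (\<forall>x. c * (norm x)\<^sup>2 \<le> x \<bullet> (A n *v x)) \<and> 0 < det (A n) \<and> det (A n) < det Q + 1"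
    by eventually_elim auto
  then obtain N where N: "\<And>n x. N \<le> n \<Longrightarrow> c * (norm x)\<^sup>2 \<le> x \<bullet> (A n *v x)"
      "\<And>n. N \<le> n \<Longrightarrow> 0 < det (A n)" "\<And>n. N \<le> n \<Longrightarrow> det (A n) < det Q + 1"
    unfolding eventually_sequentially by blast
  let ?k = "(2 * pi * \<sigma>\<^sup>2) powr (- real CARD('a + 'b) / 2)"
  let ?w = "\<lambda>v::real^('a + 'b). ?k * sqrt (det Q + 1) * M * exp (- (c / (2 * \<sigma>\<^sup>2)) * (norm v)\<^sup>2)"
  \<comment> \<open>The bounds, and positivity of the determinants, are available only from
    \<open>N\<close> on, hence the shifted index.\<close>
  have L: "(\<lambda>n. integral\<^sup>L lborel (\<lambda>v. gdens \<sigma> (A (n + N)) v * f (F (n + N) v))) \<longlonglongrightarrow>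
      integral\<^sup>L lborel (\<lambda>v. gdens \<sigma> Q v * f (G v))"
  proof (rule integral_dominated_convergence[where w = ?w])
    have w: "integrable lborel (\<lambda>v::real^('a + 'b). exp (- (c / (2 * \<sigma>\<^sup>2)) * (norm v)\<^sup>2))"
      by (rule integrable_exp_neg_norm_sq) (use c \<sigma> in simp)
    show "integrable lborel ?w" by (intro integrable_mult_right w)
    have "isCont f x" for x using f(1) by (simp add: continuous_on_eq_continuous_at)
    then have "(\<lambda>n. f (F n v)) \<longlonglongrightarrow> f (G v)" for v
      using F by (rule isCont_tendsto_compose)
    then have "(\<lambda>n. gdens \<sigma> (A n) v * f (F n v)) \<longlonglongrightarrow> gdens \<sigma> Q v * f (G v)" for v
      by (intro tendsto_mult tendsto_gdens A \<sigma>)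
    then show "AE v in lborel. (\<lambda>n. gdens \<sigma> (A (n + N)) v * f (F (n + N) v)) \<longlonglongrightarrow> gdens \<sigma> Q v * f (G v)"
      by (intro AE_I2 LIMSEQ_ignore_initial_segment)
    fix n
    have "norm (gdens \<sigma> (A (n + N)) v * f (F (n + N) v)) \<le> ?w v" for v
    proof -
      have n: "N \<le> n + N" by simp
      have "gdens \<sigma> (A (n + N)) v \<le> ?k * sqrt (det Q + 1) * exp (- (c / (2 * \<sigma>\<^sup>2)) * (norm v)\<^sup>2)"
        unfolding gdens_def
      proof (intro mult_mono)
        show "exp (- (v \<bullet> (A (n + N) *v v)) / (2 * \<sigma>\<^sup>2)) \<le> exp (- (c / (2 * \<sigma>\<^sup>2)) * (norm v)\<^sup>2)"
          using N(1)[OF n, of v] \<sigma> by (simp add: divide_right_mono)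
      qed (use N(2,3)[OF n] detQ in auto)
      then have "gdens \<sigma> (A (n + N)) v * \<bar>f (F (n + N) v)\<bar> \<le>
          (?k * sqrt (det Q + 1) * exp (- (c / (2 * \<sigma>\<^sup>2)) * (norm v)\<^sup>2)) * M"
        using M detQ by (intro mult_mono) auto
      then show ?thesis
        using gdens_nonneg[of "A (n + N)" \<sigma> v] N(2)[OF n] by (simp add: abs_mult mult_ac)
    qed
    then show "AE v in lborel. norm (gdens \<sigma> (A (n + N)) v * f (F (n + N) v)) \<le> ?w v" by simp
  qed auto
  have 1: "integral\<^sup>L (density lborel (\<lambda>v. ennreal (gdens \<sigma> (A (n + N)) v))) (\<lambda>v. f (F (n + N) v)) =
      integral\<^sup>L lborel (\<lambda>v. gdens \<sigma> (A (n + N)) v * f (F (n + N) v))" for n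
    using N(2)[of "n + N"] by (subst integral_density) (auto intro!: gdens_nonneg)
  have 2: "integral\<^sup>L (density lborel (\<lambda>v. ennreal (gdens \<sigma> Q v))) (\<lambda>v. f (G v)) =
      integral\<^sup>L lborel (\<lambda>v. gdens \<sigma> Q v * f (G v))"
    using detQ by (subst integral_density) (auto intro!: gdens_nonneg)
  show ?thesis
    by (rule LIMSEQ_offset[where k = N]) (simp only: 1 2 L)
qed

text \<open>The pointwise limit \<open>G\<close> is left open: it becomes the identity when the
  local parameter diverges and \<open>avg_map\<close> with limiting parameters when it
  converges.\<close>

lemma weak_conv_betaTilde:
  fixes X :: "nat \<Rightarrow> nat \<Rightarrow> ('a::finite + 'b::finite) \<Rightarrow> real"
  assumes \<sigma>: "0 < \<sigma>" and rank: "\<And>n. n \<ge> CARD('a + 'b) \<Longrightarrow> full_col_rank X n"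
    and A: "(\<lambda>n. (1 / real n) *\<^sub>R gram X n) \<longlonglongrightarrow> Q" and Q: "pos_def Q"
    and F: "\<And>v. (\<lambda>n. avg_map \<alpha> \<sigma> ((1 / real n) *\<^sub>R gram X n) (sqrt (real n) *\<^sub>R vsnd (\<beta> n)) v) \<longlonglongrightarrow> G v"
    and [measurable]: "G \<in> borel_measurable borel"
  shows "weak_conv (\<lambda>n. distr (PY X n (\<beta> n) \<sigma>) borel (\<lambda>Y. sqrt (real n) *\<^sub>R (betaTilde \<alpha> \<sigma> X n Y - \<beta> n)))
    (distr (density lborel (\<lambda>v. ennreal (gdens \<sigma> Q v))) borel G)"
  unfolding weak_conv_def
proof (intro allI impI, elim conjE)
  fix f :: "real^('a + 'b) \<Rightarrow> real" assume f: "continuous_on UNIV f" "bounded (range f)"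
  have [measurable]: "f \<in> borel_measurable borel" using f(1) by (rule borel_measurable_continuous_onI)
  let ?A = "\<lambda>n. (1 / real n) *\<^sub>R gram X n"
  let ?F = "\<lambda>n. avg_map \<alpha> \<sigma> (?A n) (sqrt (real n) *\<^sub>R vsnd (\<beta> n))"
  have eq: "integral\<^sup>L (distr (PY X n (\<beta> n) \<sigma>) borel (\<lambda>Y. sqrt (real n) *\<^sub>R (betaTilde \<alpha> \<sigma> X n Y - \<beta> n))) f =
      integral\<^sup>L (density lborel (\<lambda>v. ennreal (gdens \<sigma> (?A n) v))) (\<lambda>v. f (?F n v))"
    if n: "n \<ge> CARD('a + 'b)" for n
  proof -
    have "0 < CARD('a + 'b)" by simp
    then have "0 < n" using n by linarith
    note r = rank[OF n]
    have "distr (PY X n (\<beta> n) \<sigma>) borel (\<lambda>Y. sqrt (real n) *\<^sub>R (betaTilde \<alpha> \<sigma> X n Y - \<beta> n)) =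
        distr (distr (PY X n (\<beta> n) \<sigma>) borel (\<lambda>Y. sqrt (real n) *\<^sub>R (betaU X n Y - \<beta> n))) borel (?F n)"
      by (subst distr_distr) (auto simp: o_def betaTilde_eq_avg_map[OF \<open>0 < n\<close> r])
    then show ?thesis
      by (simp add: distr_betaU[OF \<sigma> \<open>0 < n\<close> r] integral_distr)
  qed
  have "(\<lambda>n. integral\<^sup>L (density lborel (\<lambda>v. ennreal (gdens \<sigma> (?A n) v))) (\<lambda>v. f (?F n v)))
      \<longlonglongrightarrow> integral\<^sup>L (density lborel (\<lambda>v. ennreal (gdens \<sigma> Q v))) (\<lambda>v. f (G v))"
    by (rule tendsto_integral_gdens[OF A Q \<sigma> F _ _ f]) auto
  then have "(\<lambda>n. integral\<^sup>L (distr (PY X n (\<beta> n) \<sigma>) borel (\<lambda>Y. sqrt (real n) *\<^sub>R (betaTilde \<alpha> \<sigma> X n Y - \<beta> n))) f)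
      \<longlonglongrightarrow> integral\<^sup>L (density lborel (\<lambda>v. ennreal (gdens \<sigma> Q v))) (\<lambda>v. f (G v))"
    by (rule Lim_transform_eventually)
       (use eventually_ge_at_top[of "CARD('a + 'b)"] in eventually_elim, simp add: eq)
  then show "(\<lambda>n. integral\<^sup>L (distr (PY X n (\<beta> n) \<sigma>) borel (\<lambda>Y. sqrt (real n) *\<^sub>R (betaTilde \<alpha> \<sigma> X n Y - \<beta> n))) f)
      \<longlonglongrightarrow> integral\<^sup>L (distr (density lborel (\<lambda>v. ennreal (gdens \<sigma> Q v))) borel G) f"
    by (simp add: integral_distr)
qed

section \<open>Identification of the two limit laws\<close>

lemma det_scaleR:
  fixes A :: "real^'n^'n" shows "det (c *\<^sub>R A) = c ^ CARD('n) * det A"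
proof -
  have "c *\<^sub>R A = matrix ((*\<^sub>R) c) ** A"
    using linear_scale_self[of c, where 'a = "real^'n"]
    by (simp add: matrix_eq flip: matrix_vector_mul_assoc scaleR_matrix_vector_assoc)
  then show ?thesis by (simp add: det_mul)
qed

text \<open>Passage from covariance to precision:
  \<open>det (\<sigma>\<^sup>2 *\<^sub>R matrix_inv Q) powr (-1/2)\<close> splits into a power of
  \<open>\<sigma>\<^sup>2\<close>, absorbed by the power of \<open>2 * pi\<close>, and
  \<open>sqrt (det Q)\<close>.\<close>

lemma mvnormal_eq_gdens:
  fixes Q :: "real^('a::finite + 'b::finite)^('a + 'b)"
  assumes \<sigma>: "0 < \<sigma>" and Q: "pos_def Q"
  shows "mvnormal (\<sigma>\<^sup>2 *\<^sub>R matrix_inv Q) = density lborel (\<lambda>v. ennreal (gdens \<sigma> Q v))"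
proof -
  let ?k = "CARD('a + 'b)"
  have d: "0 < det Q" by (rule pos_def_det_pos[OF Q])
  note Qi = pos_def_invertible[OF Q]
  have "det (matrix_inv Q) * det Q = 1"
    using matrix_inv_mul[OF Qi] by (metis det_I det_mul)
  then have "det (matrix_inv Q) = 1 / det Q" using d by (simp add: field_simps)
  then have "det (\<sigma>\<^sup>2 *\<^sub>R matrix_inv Q) powr (- 1 / 2) = ((\<sigma>\<^sup>2) ^ ?k / det Q) powr (- 1 / 2)"
    by (simp add: det_scaleR)
  also have "\<dots> = ((\<sigma>\<^sup>2) powr (real ?k)) powr (- 1 / 2) * (1 / det Q) powr (- 1 / 2)"
  proof -
    have "(\<sigma>\<^sup>2) ^ ?k / det Q = (\<sigma>\<^sup>2) powr real ?k * (1 / det Q)"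
      using \<sigma> powr_realpow[of "\<sigma>\<^sup>2" ?k] by simp
    then show ?thesis using d by (simp only: powr_mult)
  qed
  also have "(1 / det Q) powr (- 1 / 2) = sqrt (det Q)"
    using d by (simp add: powr_divide powr_minus_divide powr_half_sqrt)
  also have "((\<sigma>\<^sup>2) powr (real ?k)) powr (- 1 / 2) = (\<sigma>\<^sup>2) powr (- real ?k / 2)"
  proof -
    have "real ?k * (- 1 / 2) = - real ?k / 2" by linarith
    then show ?thesis by (simp only: powr_powr)
  qed
  finally have 1: "(2 * pi) powr (- real ?k / 2) * det (\<sigma>\<^sup>2 *\<^sub>R matrix_inv Q) powr (- 1 / 2) =
      (2 * pi * \<sigma>\<^sup>2) powr (- real ?k / 2) * sqrt (det Q)"
    using \<sigma> by (simp add: powr_mult)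
  have "matrix_inv (\<sigma>\<^sup>2 *\<^sub>R matrix_inv Q) = (1 / \<sigma>\<^sup>2) *\<^sub>R Q"
    using \<sigma> matrix_inv_mul[OF Qi] by (intro matrix_inv_unique_real)
      (simp add: matrix_eq matrix_vector_mult_scaleR matrix_inv_mul_vec[OF Qi]
        flip: matrix_vector_mul_assoc scaleR_matrix_vector_assoc)
  then have 2: "- (x \<bullet> (matrix_inv (\<sigma>\<^sup>2 *\<^sub>R matrix_inv Q) *v x)) / 2 = - (x \<bullet> (Q *v x)) / (2 * \<sigma>\<^sup>2)" for x
    by (simp flip: scaleR_matrix_vector_assoc)
  show ?thesis
    unfolding mvnormal_def gdens_def 1 2 ..
qed

text \<open>\<open>betaTilde\<close> and \<open>avg_map\<close> use the weight of the restricted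
  model, \<open>limit_law\<close> the complementary one; this converts between them.\<close>

lemma logistic_complement: "1 - 1 / (1 + exp (- a) * exp b) = 1 / (1 + exp a * exp (- b :: real))"
proof -
  have "exp (- a) * exp b * (exp a * exp (- b)) = 1" by (simp flip: exp_add)
  moreover have "0 < exp (- a) * exp b" "0 < exp a * exp (- b)" by simp_all
  ultimately show ?thesis by (simp add: divide_simps add_pos_pos[THEN less_imp_neq, THEN not_sym] algebra_simps)
qed

text \<open>Write \<open>v = C Z1 + D Z2\<close> for the whitened vector and \<open>x\<close> for
  its second block plus \<open>\<gamma>\<close>. Then
  \<open>(regr x, - x) = B \<gamma> - D Z2\<close>, so \<open>v + l (B \<gamma> - D Z2)\<close>
  equals \<open>B \<gamma> + C Z1 + (1 - l) (D Z2 - B \<gamma>)\<close>; and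
  \<open>msqrt (schur Q)\<close> maps \<open>x\<close> to the vector inside the norm.\<close>

lemma limit_law_eq_avg_map:
  fixes Q :: "real^('a::finite + 'b::finite)^('a + 'b)"
  assumes \<sigma>: "0 < \<sigma>" and Q: "pos_def Q"
  shows "limit_law \<alpha> \<sigma> Q \<gamma> = distr (gaussI \<sigma>) borel (\<lambda>z. avg_map \<alpha> \<sigma> Q \<gamma> (whiten Q z))"
proof -
  have S: "pos_def (schur Q)" by (rule pos_def_schur[OF Q])
  note m = msqrt[OF S]
  have q: "(norm (vsnd z + msqrt (schur Q) *v \<gamma>))\<^sup>2 =
      (vsnd (whiten Q z) + \<gamma>) \<bullet> (schur Q *v (vsnd (whiten Q z) + \<gamma>))" for z :: "real^('a + 'b)"
  proof -
    let ?x = "vsnd (whiten Q z) + \<gamma>"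
    have "vsnd z + msqrt (schur Q) *v \<gamma> = msqrt (schur Q) *v ?x"
      using matrix_inv_mul_vec[OF pos_def_invertible[OF m(1)]]
      by (simp add: whiten_def minvsqrt_def matrix_vector_right_distrib)
    then show ?thesis
      using m(2) pos_def_sym[OF m(1), of ?x "msqrt (schur Q) *v ?x"]
      by (simp add: power2_norm_eq_inner matrix_vector_mul_assoc)
  qed
  have "vjoin (regr Q \<gamma>) (- \<gamma>) + vjoin (minvsqrt (blk11 Q) *v vfst z) 0 +
      (1 / (1 + exp (2 * \<alpha> * real CARD('b)) * exp (- \<alpha> * (norm (vsnd z + msqrt (schur Q) *v \<gamma>))\<^sup>2 / \<sigma>\<^sup>2))) *\<^sub>R
      (vjoin (- regr Q (minvsqrt (schur Q) *v vsnd z)) (minvsqrt (schur Q) *v vsnd z) - vjoin (regr Q \<gamma>) (- \<gamma>)) =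
      avg_map \<alpha> \<sigma> Q \<gamma> (whiten Q z)" for z
  proof -
    let ?x = "vsnd (whiten Q z) + \<gamma>"
    define l where "l = 1 / (1 + exp (- 2 * \<alpha> * real CARD('b)) * exp (\<alpha> * (?x \<bullet> (schur Q *v ?x)) / \<sigma>\<^sup>2))"
    have l: "1 / (1 + exp (2 * \<alpha> * real CARD('b)) * exp (- \<alpha> * (norm (vsnd z + msqrt (schur Q) *v \<gamma>))\<^sup>2 / \<sigma>\<^sup>2)) = 1 - l"
      using logistic_complement[of "2 * \<alpha> * real CARD('b)"] by (simp add: l_def q)
    have a: "avg_map \<alpha> \<sigma> Q \<gamma> (whiten Q z) = whiten Q z + l *\<^sub>R vjoin (regr Q ?x) (- ?x)"
      by (simp add: avg_map_def Let_def l_def)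
    show ?thesis
      unfolding l a
      by (simp add: vec_sum_eq_iff whiten_def linear_add[OF linear_regr] algebra_simps)
  qed
  then show ?thesis
    by (simp add: limit_law_def Let_def regr_def schur_def)
qed

lemma limit_law_eq_distr_gdens:
  fixes Q :: "real^('a::finite + 'b::finite)^('a + 'b)"
  assumes \<sigma>: "0 < \<sigma>" and Q: "pos_def Q"
  shows "limit_law \<alpha> \<sigma> Q \<gamma> = distr (density lborel (\<lambda>v. ennreal (gdens \<sigma> Q v))) borel (avg_map \<alpha> \<sigma> Q \<gamma>)"
proof -
  have [measurable]: "whiten Q \<in> borel_measurable borel"
    using linear_whiten by (intro borel_measurable_continuous_onI linear_continuous_on) (simp add: linear_conv_bounded_linear)
  have "limit_law \<alpha> \<sigma> Q \<gamma> = distr (distr (gaussI \<sigma>) borel (whiten Q)) borel (avg_map \<alpha> \<sigma> Q \<gamma>)"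
    unfolding limit_law_eq_avg_map[OF \<sigma> Q] by (subst distr_distr) (auto simp: o_def)
  then show ?thesis
    by (simp add: distr_gaussI_linear[OF \<sigma> Q linear_whiten whiten_quadratic[OF Q]])
qed

section \<open>Density of the limit law\<close>

lemma hfun_strict_mono:
  assumes "0 < \<alpha>" "0 < \<sigma>" "0 \<le> x" "x < y"
  shows "hfun \<alpha> \<sigma> k x < hfun \<alpha> \<sigma> k y"
  unfolding hfun_def
proof (rule frac_less)
  have "x\<^sup>2 \<le> y\<^sup>2" using assms by (intro power_mono) auto
  then have "- y\<^sup>2 / (\<sigma>\<^sup>2 / \<alpha>) \<le> - x\<^sup>2 / (\<sigma>\<^sup>2 / \<alpha>)"
    using assms by (intro divide_right_mono) auto
  then show "1 + exp (2 * \<alpha> * real k) * exp (- y\<^sup>2 / (\<sigma>\<^sup>2 / \<alpha>)) \<le> 1 + exp (2 * \<alpha> * real k) * exp (- x\<^sup>2 / (\<sigma>\<^sup>2 / \<alpha>))"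
    by simp
  show "0 < 1 + exp (2 * \<alpha> * real k) * exp (- y\<^sup>2 / (\<sigma>\<^sup>2 / \<alpha>))"
    by (intro add_pos_pos mult_pos_pos) auto
qed (use assms in auto)

lemma hfun_inj:
  assumes "0 < \<alpha>" "0 < \<sigma>" "0 \<le> x" "0 \<le> y" "hfun \<alpha> \<sigma> k x = hfun \<alpha> \<sigma> k y"
  shows "x = y"
  using assms hfun_strict_mono[of \<alpha> \<sigma> x y k] hfun_strict_mono[of \<alpha> \<sigma> y x k] by linarith

lemma gfun_hfun:
  assumes "0 < \<alpha>" "0 < \<sigma>" "0 \<le> x"
  shows "gfun \<alpha> \<sigma> k (hfun \<alpha> \<sigma> k x) = x"
  unfolding gfun_def using assms hfun_inj[OF assms(1,2)] by (intro the_equality) auto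

lemma hfun_surj:
  assumes "0 < \<alpha>" "0 < \<sigma>" "0 \<le> t"
  shows "\<exists>x\<ge>0. hfun \<alpha> \<sigma> k x = t"
proof -
  \<comment> \<open>The denominator of \<open>hfun\<close> never exceeds \<open>1 + ?A\<close>, so
    \<open>hfun\<close> at \<open>?u = t * (1 + ?A)\<close> is at least \<open>t\<close>, and the
    intermediate value theorem applies on \<open>{0..?u}\<close>.\<close>
  let ?A = "exp (2 * \<alpha> * real k)" and ?u = "t * (1 + exp (2 * \<alpha> * real k))"
  have u: "0 \<le> ?u" using assms by (intro mult_nonneg_nonneg add_nonneg_nonneg) auto
  have nz: "1 + ?A * exp y \<noteq> 0" for y
    by (metis add_pos_pos exp_gt_zero less_irrefl mult_pos_pos zero_less_one)
  have "exp (- ?u\<^sup>2 / (\<sigma>\<^sup>2 / \<alpha>)) \<le> 1" using assms by simp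
  then have "?A * exp (- ?u\<^sup>2 / (\<sigma>\<^sup>2 / \<alpha>)) \<le> ?A * 1" by (intro mult_left_mono) auto
  then have "t * (1 + ?A * exp (- ?u\<^sup>2 / (\<sigma>\<^sup>2 / \<alpha>))) \<le> ?u" using assms by (intro mult_left_mono) auto
  moreover have "0 < 1 + ?A * exp (- ?u\<^sup>2 / (\<sigma>\<^sup>2 / \<alpha>))" by (intro add_pos_pos mult_pos_pos) auto
  ultimately have "t \<le> hfun \<alpha> \<sigma> k ?u" unfolding hfun_def by (subst pos_le_divide_eq) auto
  moreover have "hfun \<alpha> \<sigma> k 0 \<le> t" using assms by (simp add: hfun_def)
  moreover have "continuous_on {0..?u} (hfun \<alpha> \<sigma> k)"
    unfolding hfun_def using assms nz by (intro continuous_intros ballI nz) auto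
  ultimately show ?thesis using IVT'[of "hfun \<alpha> \<sigma> k" 0 t ?u] u by auto
qed

section \<open>The radial shrinkage map and its Jacobian\<close>

text \<open>The limiting weight of the unrestricted model as a function of the whitened vector
  \<open>w = Z2 + S^(1/2) \<gamma>\<close>, where \<open>S\<close> is the Schur complement.\<close>

definition shrink_factor :: "real \<Rightarrow> real \<Rightarrow> real^'b::finite \<Rightarrow> real" where
  "shrink_factor \<alpha> \<sigma> w = 1 / (1 + exp (2 * \<alpha> * real CARD('b) - \<alpha> * (w \<bullet> w) / \<sigma>\<^sup>2))"

definition shrink :: "real \<Rightarrow> real \<Rightarrow> real^'b::finite \<Rightarrow> real^'b" where
  "shrink \<alpha> \<sigma> w = shrink_factor \<alpha> \<sigma> w *\<^sub>R w"

lemma shrink_factor_pos: "0 < shrink_factor \<alpha> \<sigma> w"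
  by (simp add: shrink_factor_def add_pos_pos)

lemma norm_shrink:
  fixes w :: "real^'b::finite"
  shows "norm (shrink \<alpha> \<sigma> w) = hfun \<alpha> \<sigma> CARD('b) (norm w)"
proof -
  have "shrink_factor \<alpha> \<sigma> w * norm w = hfun \<alpha> \<sigma> CARD('b) (norm w)"
    by (simp add: shrink_factor_def hfun_def power2_norm_eq_inner mult.commute exp_diff exp_minus field_simps)
  then show ?thesis
    using shrink_factor_pos[of \<alpha> \<sigma> w] by (simp add: shrink_def)
qed

text \<open>Directions are kept and radii are transformed by \<open>hfun\<close>, a bijection of the
  nonnegative reals; the factor depends on the radius alone.\<close>

lemma bij_shrink:
  assumes \<alpha>: "0 < \<alpha>" and \<sigma>: "0 < \<sigma>"
  shows "bij (shrink \<alpha> \<sigma> :: real^'b \<Rightarrow> real^'b::finite)"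
proof (rule bijI)
  show "inj (shrink \<alpha> \<sigma> :: real^'b \<Rightarrow> real^'b)"
  proof (rule injI)
    fix v w :: "real^'b" assume eq: "shrink \<alpha> \<sigma> v = shrink \<alpha> \<sigma> w"
    then have "hfun \<alpha> \<sigma> CARD('b) (norm v) = hfun \<alpha> \<sigma> CARD('b) (norm w)" by (simp flip: norm_shrink)
    then have "norm v = norm w" by (rule hfun_inj[OF \<alpha> \<sigma> norm_ge_zero norm_ge_zero])
    then have "v \<bullet> v = w \<bullet> w" by (simp flip: power2_norm_eq_inner)
    then have "shrink_factor \<alpha> \<sigma> v = shrink_factor \<alpha> \<sigma> w" by (simp add: shrink_factor_def)
    with eq show "v = w" using shrink_factor_pos[of \<alpha> \<sigma> w] by (simp add: shrink_def)
  qed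
  show "surj (shrink \<alpha> \<sigma> :: real^'b \<Rightarrow> real^'b)"
    unfolding surj_def
  proof
    fix y :: "real^'b"
    show "\<exists>x. y = shrink \<alpha> \<sigma> x"
    proof (cases "y = 0")
      case False
      obtain r where r: "0 \<le> r" "hfun \<alpha> \<sigma> CARD('b) r = norm y"
        using hfun_surj[OF \<alpha> \<sigma>, of "norm y"] by auto
      let ?w = "(r / norm y) *\<^sub>R y"
      have "norm ?w = r" using r False by simp
      then have "norm (shrink \<alpha> \<sigma> ?w) = norm y" using r by (simp only: norm_shrink)
      then have "(shrink_factor \<alpha> \<sigma> ?w * (r / norm y)) * norm y = norm y"
        using shrink_factor_pos[of \<alpha> \<sigma> ?w] r by (simp add: shrink_def)
      then have "shrink_factor \<alpha> \<sigma> ?w * (r / norm y) = 1" using False by simp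
      then have "shrink \<alpha> \<sigma> ?w = y" by (simp only: shrink_def scaleR_scaleR scaleR_one)
      then show ?thesis by metis
    qed (auto intro!: exI[of _ 0] simp: shrink_def)
  qed
qed

text \<open>Twice the derivative of the shrinkage factor with respect to \<open>w \<bullet> w\<close>.\<close>

definition shrink_slope :: "real \<Rightarrow> real \<Rightarrow> real^'b::finite \<Rightarrow> real" where
  "shrink_slope \<alpha> \<sigma> w = (shrink_factor \<alpha> \<sigma> w)\<^sup>2 * exp (2 * \<alpha> * real CARD('b) - \<alpha> * (w \<bullet> w) / \<sigma>\<^sup>2) * (2 * \<alpha> / \<sigma>\<^sup>2)"

lemma has_derivative_shrink:
  fixes w :: "real^'b::finite"
  assumes "0 < \<sigma>"
  shows "(shrink \<alpha> \<sigma> has_derivative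
    (\<lambda>h. shrink_factor \<alpha> \<sigma> w *\<^sub>R h + (shrink_slope \<alpha> \<sigma> w * (w \<bullet> h)) *\<^sub>R w)) (at w)"
proof -
  let ?E = "\<lambda>s. exp (2 * \<alpha> * real CARD('b) - \<alpha> * s / \<sigma>\<^sup>2)"
  have nz: "1 + ?E s \<noteq> 0" for s by (metis add_pos_pos exp_gt_zero less_irrefl zero_less_one)
  have "((\<lambda>s. 1 / (1 + ?E s)) has_field_derivative (1 / (1 + ?E s))\<^sup>2 * ?E s * (\<alpha> / \<sigma>\<^sup>2)) (at s)" for s
    using assms nz[of s] by (auto intro!: derivative_eq_intros simp: divide_simps power2_eq_square)
  moreover have "((\<lambda>w. w \<bullet> w) has_derivative (\<lambda>h. 2 * (w \<bullet> h))) (at w)"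
    by (auto intro!: derivative_eq_intros simp: inner_commute)
  ultimately have "((\<lambda>w. 1 / (1 + ?E (w \<bullet> w))) has_derivative
      (\<lambda>h. 2 * (w \<bullet> h) * ((1 / (1 + ?E (w \<bullet> w)))\<^sup>2 * ?E (w \<bullet> w) * (\<alpha> / \<sigma>\<^sup>2)))) (at w)"
    by (rule DERIV_compose_FDERIV)
  then have "(shrink_factor \<alpha> \<sigma> has_derivative (\<lambda>h. shrink_slope \<alpha> \<sigma> w * (w \<bullet> h))) (at w)"
    by (simp add: shrink_factor_def[abs_def] shrink_slope_def mult_ac)
  from has_derivative_scaleR[OF this has_derivative_ident] show ?thesis
    unfolding shrink_def[abs_def] by (simp add: add.commute)
qed

lemma has_derivative_vjoin:
  assumes "(f has_derivative f') (at x within s)" "(g has_derivative g') (at x within s)"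
  shows "((\<lambda>x. vjoin (f x) (g x)) has_derivative (\<lambda>h. vjoin (f' h) (g' h))) (at x within s)"
proof -
  have "linear (\<lambda>p :: (real^'b::finite) \<times> (real^'c::finite). vjoin (fst p) (snd p))"
    by (auto intro!: linearI simp: vec_sum_eq_iff)
  then have "bounded_linear (\<lambda>p :: (real^'b) \<times> (real^'c). vjoin (fst p) (snd p))"
    by (simp add: linear_conv_bounded_linear)
  from bounded_linear.has_derivative[OF this has_derivative_Pair[OF assms]] show ?thesis by simp
qed

text \<open>A rotation of the second block taking an axis to the direction of \<open>w\<close> makes
  the map diagonal: \<open>1\<close> on the first block, \<open>m + c * (w \<bullet> w)\<close> in
  the direction of \<open>w\<close>, \<open>m\<close> in the remaining ones. The factored form
  matches the factors of \<open>f_inf\<close>.\<close>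

lemma det_rank_one_update:
  fixes w :: "real^'b::finite" and m c :: real
  assumes m: "m \<noteq> 0"
  shows "det (matrix (\<lambda>h :: real^('a::finite + 'b). vjoin (vfst h) (m *\<^sub>R vsnd h + (c * (w \<bullet> vsnd h)) *\<^sub>R w)))
    = m ^ CARD('b) * (1 + c / m * (w \<bullet> w))"
proof -
  define k :: 'b where "k = undefined"
  let ?e = "axis k 1 :: real^'b"
  \<comment> \<open>For \<open>w = 0\<close> any rotation will do, since the factor
    \<open>norm w\<close> is zero.\<close>
  obtain R :: "real^'b \<Rightarrow> real^'b" where R: "orthogonal_transformation R" "w = norm w *\<^sub>R R ?e"
  proof (cases "w = 0")
    case True
    then show thesis by (intro that[of "\<lambda>x. x"]) auto
  next
    case False
    then have "norm ((1 / norm w) *\<^sub>R w) = 1" by simp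
    moreover have "norm ?e = 1" by simp
    ultimately obtain f :: "real^'b \<Rightarrow> real^'b" where "orthogonal_transformation f" "f ?e = (1 / norm w) *\<^sub>R w"
      using orthogonal_transformation_exists_1[of ?e "(1 / norm w) *\<^sub>R w"] by blast
    then show thesis using False by (intro that[of f]) auto
  qed
  have linR: "linear R" using R(1) by (rule orthogonal_transformation_linear)
  let ?L = "\<lambda>h :: real^('a + 'b). vjoin (vfst h) (m *\<^sub>R vsnd h + (c * (w \<bullet> vsnd h)) *\<^sub>R w)"
  let ?R = "\<lambda>h :: real^('a + 'b). vjoin (vfst h) (R (vsnd h))"
  let ?D = "\<lambda>h :: real^('a + 'b). vjoin (vfst h) (m *\<^sub>R vsnd h + (c * (w \<bullet> w) * (?e \<bullet> vsnd h)) *\<^sub>R ?e)"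
  have lin: "linear ?L" "linear ?D" "linear ?R"
    by (auto intro!: linearI simp: vec_sum_eq_iff inner_add_right algebra_simps linear_add[OF linR] linear_scale[OF linR])
  have "orthogonal_transformation ?R"
    using lin(3) R(1) unfolding orthogonal_transformation_def by (simp add: inner_vec_sum)
  then have "orthogonal_matrix (matrix ?R)" by (simp add: orthogonal_transformation_matrix)
  then have detR: "det (matrix ?R) \<noteq> 0" using det_orthogonal_matrix by fastforce
  have w: "w \<bullet> R h = norm w * (?e \<bullet> h)" for h
    by (subst R(2)) (use R(1) in \<open>simp add: orthogonal_transformation_def\<close>)
  have "?L (?R h) = ?R (?D h)" for h
  proof -
    have "(c * (w \<bullet> R (vsnd h))) *\<^sub>R w = (c * (w \<bullet> w) * (?e \<bullet> vsnd h)) *\<^sub>R R ?e"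
      using arg_cong[OF R(2), of "\<lambda>v. (c * (norm w * (?e \<bullet> vsnd h))) *\<^sub>R v"]
      by (simp add: w power2_norm_eq_inner[symmetric] power2_eq_square mult_ac)
    then show ?thesis
      by (simp add: vec_sum_eq_iff linear_add[OF linR] linear_scale[OF linR])
  qed
  then have "?L \<circ> ?R = ?R \<circ> ?D" by (auto simp: fun_eq_iff)
  then have LR: "matrix ?L ** matrix ?R = matrix ?R ** matrix ?D"
    using lin by (simp flip: matrix_compose)
  have D: "matrix ?D $ i $ j = (if i = j then (case i of Inl _ \<Rightarrow> 1 | Inr i \<Rightarrow> m + (if i = k then c * (w \<bullet> w) else 0)) else 0)"
    for i j
    by (cases i; cases j) (simp_all add: matrix_def inner_axis', auto simp: axis_def)
  from arg_cong[OF LR, of det] have "det (matrix ?L) * det (matrix ?R) = det (matrix ?R) * det (matrix ?D)"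
    unfolding det_mul .
  then have "det (matrix ?L) = det (matrix ?D)"
    using detR by (simp only: mult.commute[of "det (matrix ?R)"] mult_cancel_right) simp
  also have "det (matrix ?D) = (\<Prod>i\<in>UNIV. matrix ?D $ i $ i)"
    by (rule det_diagonal) (simp add: D)
  also have "\<dots> = (\<Prod>i\<in>UNIV. m + (if i = k then c * (w \<bullet> w) else 0))"
    by (simp add: D UNIV_Plus_UNIV[symmetric] prod.Plus del: UNIV_Plus_UNIV)
  also have "\<dots> = (\<Prod>i\<in>(UNIV::'b set). m * (if i = k then 1 + c / m * (w \<bullet> w) else 1))"
    using m by (intro prod.cong) (auto simp: field_simps)
  also have "\<dots> = m ^ CARD('b) * (1 + c / m * (w \<bullet> w))"
    by (simp add: prod.distrib)
  finally show ?thesis .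
qed

section \<open>The limit law in whitened coordinates\<close>

lemma msqrt_matrix_inv:
  assumes "pos_def A" shows "msqrt A *v (matrix_inv A *v y) = minvsqrt A *v y"
proof -
  note m = msqrt[OF assms]
  have "msqrt A *v (msqrt A *v u) = A *v u" for u
    by (simp add: matrix_vector_mul_assoc m(2))
  then have "msqrt A *v (msqrt A *v (matrix_inv A *v y)) = y"
    using matrix_inv_mul_vec[OF pos_def_invertible[OF assms]] by simp
  then show ?thesis
    using matrix_inv_mul_vec(2)[OF pos_def_invertible[OF m(1)], of "msqrt A *v (matrix_inv A *v y)"]
    by (simp add: minvsqrt_def)
qed

lemma msqrt_minvsqrt:
  assumes "pos_def A" shows "msqrt A *v (minvsqrt A *v y) = y"
  unfolding minvsqrt_def by (rule matrix_inv_mul_vec[OF pos_def_invertible[OF msqrt(1)[OF assms]]])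

text \<open>Here \<open>?x\<close> is \<open>S^(-1/2)\<close> applied to \<open>?w\<close>, so its
  Schur form is \<open>?w \<bullet> ?w\<close> and the weight \<open>l\<close> becomes
  \<open>1 - shrink_factor\<close>. Averaging multiplies \<open>?x\<close> by the shrink factor, and
  its compensating \<open>regr\<close> term leaves the first whitened block fixed.\<close>

lemma avg_map_whiten:
  fixes Q :: "real^('a::finite + 'b::finite)^('a + 'b)"
  assumes Q: "pos_def Q"
  shows "avg_map \<alpha> \<sigma> Q \<gamma> (whiten Q z) =
    whiten Q (vjoin (vfst z) (shrink \<alpha> \<sigma> (vsnd z + msqrt (schur Q) *v \<gamma>))) + vjoin (regr Q \<gamma>) (- \<gamma>)"
proof -
  have S: "pos_def (schur Q)" by (rule pos_def_schur[OF Q])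
  note m = msqrt[OF S]
  let ?w = "vsnd z + msqrt (schur Q) *v \<gamma>" and ?x = "vsnd (whiten Q z) + \<gamma>"
  have x: "?x = minvsqrt (schur Q) *v ?w"
    using matrix_inv_mul_vec[OF pos_def_invertible[OF m(1)]]
    by (simp add: whiten_def minvsqrt_def matrix_vector_right_distrib)
  have q: "?x \<bullet> (schur Q *v ?x) = ?w \<bullet> ?w"
    unfolding x by (rule minvsqrt_quadratic[OF S])
  define l where "l = 1 / (1 + exp (- 2 * \<alpha> * real CARD('b)) * exp (\<alpha> * (?x \<bullet> (schur Q *v ?x)) / \<sigma>\<^sup>2))"
  have l: "shrink_factor \<alpha> \<sigma> ?w = 1 - l"
  proof -
    have "shrink_factor \<alpha> \<sigma> ?w = 1 / (1 + exp (2 * \<alpha> * real CARD('b)) * exp (- (\<alpha> * (?w \<bullet> ?w) / \<sigma>\<^sup>2)))"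
      by (simp add: shrink_factor_def exp_diff exp_minus divide_inverse)
    also have "\<dots> = 1 - l"
      unfolding l_def q using logistic_complement[of "2 * \<alpha> * real CARD('b)" "\<alpha> * (?w \<bullet> ?w) / \<sigma>\<^sup>2"] by simp
    finally show ?thesis .
  qed
  have a: "avg_map \<alpha> \<sigma> Q \<gamma> (whiten Q z) = whiten Q z + l *\<^sub>R vjoin (regr Q ?x) (- ?x)"
    by (simp add: avg_map_def Let_def l_def)
  have sh: "minvsqrt (schur Q) *v shrink \<alpha> \<sigma> ?w = (1 - l) *\<^sub>R ?x"
    by (simp add: shrink_def l matrix_vector_mult_scaleR x)
  show ?thesis
    unfolding a whiten_def[of Q "vjoin _ _"] vfst_vjoin vsnd_vjoin sh
    by (simp add: vec_sum_eq_iff linear_scale[OF linear_regr] linear_add[OF linear_regr]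
        linear_diff[OF linear_regr] algebra_simps)
       (simp add: whiten_def)
qed

lemma bij_plus_left: "bij (\<lambda>x::'a::group_add. x + a)"
  by (rule o_bij[of "\<lambda>x. x - a"]) (auto simp: fun_eq_iff)

lemma bij_whiten:
  assumes "pos_def Q" shows "bij (whiten Q)"
proof -
  have "det (matrix (whiten Q)) \<noteq> 0"
    using det_whitening_map[OF assms linear_whiten whiten_quadratic[OF assms]] by auto
  then show ?thesis
    using linear_whiten[of Q] by (simp add: det_nz_iff_inj bij_def linear_injective_imp_surjective)
qed

text \<open>At the image point every ingredient of \<open>f_inf\<close> is undone: the inverse of
  \<open>D2\<close> returns the shrunken vector, \<open>gfun\<close> recovers the radius of
  \<open>w z\<close>, and the two Gaussian exponents become the squared norms of
  \<open>vfst z\<close> and \<open>vsnd z\<close>.\<close>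

lemma f_inf_whiten:
  fixes Q :: "real^('a::finite + 'b::finite)^('a + 'b)" and \<gamma> :: "real^'b"
  assumes \<sigma>: "0 < \<sigma>" and \<alpha>: "0 < \<alpha>" and Q: "pos_def Q"
  defines "w \<equiv> \<lambda>z. vsnd z + msqrt (schur Q) *v \<gamma>"
  shows "f_inf \<alpha> \<sigma> Q \<gamma> (whiten Q (vjoin (vfst z) (shrink \<alpha> \<sigma> (w z))) + vjoin (regr Q \<gamma>) (- \<gamma>)) =
    (2 * pi * \<sigma>\<^sup>2) powr (- real CARD('a + 'b) / 2) * sqrt (det Q) * exp (- (vfst z \<bullet> vfst z) / (2 * \<sigma>\<^sup>2))
    * inverse (shrink_factor \<alpha> \<sigma> (w z)) ^ CARD('b)
    * inverse (1 + shrink_slope \<alpha> \<sigma> (w z) / shrink_factor \<alpha> \<sigma> (w z) * (w z \<bullet> w z))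
    * exp (- (vsnd z \<bullet> vsnd z) / (2 * \<sigma>\<^sup>2))"
proof -
  have S: "pos_def (schur Q)" and Q11: "pos_def (blk11 Q)"
    by (rule pos_def_schur[OF Q], rule pos_def_blk11[OF Q])
  let ?t = "whiten Q (vjoin (vfst z) (shrink \<alpha> \<sigma> (w z))) + vjoin (regr Q \<gamma>) (- \<gamma>)"
  let ?y = "shrink \<alpha> \<sigma> (w z)"
  have y: "matrix_inv (minvsqrt (schur Q)) *v (vsnd ?t + \<gamma>) = ?y"
    by (simp add: matrix_inv_minvsqrt[OF S] whiten_def msqrt_minvsqrt[OF S])
  have Sg: "matrix_inv (minvsqrt (schur Q)) *v \<gamma> = msqrt (schur Q) *v \<gamma>"
    by (simp add: matrix_inv_minvsqrt[OF S])
  have G: "gfun \<alpha> \<sigma> CARD('b) (norm ?y) = norm (w z)"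
    by (simp add: norm_shrink gfun_hfun[OF \<alpha> \<sigma>])
  have mu: "0 < shrink_factor \<alpha> \<sigma> (w z)" by (rule shrink_factor_pos)
  \<comment> \<open>The conventional value at zero is correct: the shrink factor is positive, so
    \<open>?y = 0\<close> forces \<open>w z = 0\<close>.\<close>
  have Gw: "(if ?y = 0 then 0 else (norm (w z) / norm ?y) *\<^sub>R ?y) = w z"
    using mu by (simp add: shrink_def)
  have "vfst ?t = minvsqrt (blk11 Q) *v vfst z - regr Q (vsnd ?t)"
    by (simp add: whiten_def linear_diff[OF linear_regr])
  then have z1: "msqrt (blk11 Q) *v vfst ?t + minvsqrt (blk11 Q) *v (blk12 Q *v vsnd ?t) = vfst z"
    by (simp only: matrix_vector_mult_diff_distrib msqrt_minvsqrt[OF Q11] regr_def msqrt_matrix_inv[OF Q11]) simp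
  \<comment> \<open>Both exponentials in \<open>f_inf\<close> are expressed by \<open>E\<close>,
    with \<open>1 + E\<close> the reciprocal of the shrink factor; this turns its last two algebraic
    factors into reciprocals of Jacobian terms.\<close>
  define E where "E = exp (2 * \<alpha> * real CARD('b) - \<alpha> * (w z \<bullet> w z) / \<sigma>\<^sup>2)"
  have E: "0 < E" by (simp add: E_def)
  then have E_nz: "1 + E \<noteq> 0" by linarith
  have mu_E: "shrink_factor \<alpha> \<sigma> (w z) = 1 / (1 + E)" by (simp add: E_def shrink_factor_def)
  have E1: "exp (- \<alpha> * (norm (w z))\<^sup>2 / \<sigma>\<^sup>2 + 2 * \<alpha> * real CARD('b)) = E"
    by (simp add: E_def power2_norm_eq_inner)
  have E2: "exp (\<alpha> * (norm (w z))\<^sup>2 / \<sigma>\<^sup>2 - 2 * \<alpha> * real CARD('b)) = 1 / E"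
    by (simp add: E_def power2_norm_eq_inner exp_diff)
  have p: "(1 + E) powr real CARD('b) = inverse (shrink_factor \<alpha> \<sigma> (w z)) ^ CARD('b)"
    using E by (simp add: mu_E powr_realpow)
  have sl: "shrink_slope \<alpha> \<sigma> (w z) = (shrink_factor \<alpha> \<sigma> (w z))\<^sup>2 * E * (2 * \<alpha> / \<sigma>\<^sup>2)"
    by (simp add: shrink_slope_def E_def)
  have s: "2 * \<alpha> * (norm (w z))\<^sup>2 / \<sigma>\<^sup>2 * inverse (1 + 1 / E) =
      shrink_slope \<alpha> \<sigma> (w z) / shrink_factor \<alpha> \<sigma> (w z) * (w z \<bullet> w z)"
  proof -
    have "inverse (1 + 1 / E) = E * shrink_factor \<alpha> \<sigma> (w z)"
      using E E_nz by (simp add: mu_E field_simps)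
    moreover have "shrink_slope \<alpha> \<sigma> (w z) / shrink_factor \<alpha> \<sigma> (w z) = E * shrink_factor \<alpha> \<sigma> (w z) * (2 * \<alpha> / \<sigma>\<^sup>2)"
      using mu by (simp add: sl power2_eq_square)
    ultimately show ?thesis by (simp add: power2_norm_eq_inner)
  qed
  show ?thesis
    unfolding f_inf_def Let_def schur_def[symmetric] y G Gw Sg z1 E1 E2 p s
    by (simp add: w_def power2_norm_eq_inner)
qed

text \<open>The change of variables is applied to the standard Gaussian under \<open>F\<close>, a
  radial map between affine bijections; \<open>f_inf\<close> is verified against its defining
  equation instead of being derived by computing an inverse of \<open>F\<close>.\<close>

lemma limit_law_density:
  fixes Q :: "real^('a::finite + 'b::finite)^('a + 'b)"
  assumes \<sigma>: "0 < \<sigma>" and \<alpha>: "0 < \<alpha>" and Q: "pos_def Q"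
  shows "limit_law \<alpha> \<sigma> Q \<gamma> = density lborel (\<lambda>t. ennreal (f_inf \<alpha> \<sigma> Q \<gamma> t))"
proof -
  define w where "w = (\<lambda>z::real^('a + 'b). vsnd z + msqrt (schur Q) *v \<gamma>)"
  define K where "K z = vjoin (vfst z) (shrink \<alpha> \<sigma> (w z))" for z
  define K' where "K' z h = vjoin (vfst h) (shrink_factor \<alpha> \<sigma> (w z) *\<^sub>R vsnd h +
      (shrink_slope \<alpha> \<sigma> (w z) * (w z \<bullet> vsnd h)) *\<^sub>R w z)" for z and h :: "real^('a + 'b)"
  define F where "F z = whiten Q (K z) + vjoin (regr Q \<gamma>) (- \<gamma>)" for z
  \<comment> \<open>The determinant of \<open>K' z\<close> according to
    \<open>det_rank_one_update\<close>, with \<open>m\<close> the shrink factor and \<open>c\<close>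
    the slope.\<close>
  define jac where "jac z = shrink_factor \<alpha> \<sigma> (w z) ^ CARD('b) *
      (1 + shrink_slope \<alpha> \<sigma> (w z) / shrink_factor \<alpha> \<sigma> (w z) * (w z \<bullet> w z))" for z
  let ?W = "\<bar>det (matrix (whiten Q))\<bar>"
  have W: "0 < ?W" "?W * sqrt (det Q) = 1"
  proof -
    have det: "(det (matrix (whiten Q)))\<^sup>2 * det Q = 1"
      by (rule det_whitening_map[OF Q linear_whiten whiten_quadratic[OF Q]])
    then show "0 < ?W" by auto
    show "?W * sqrt (det Q) = 1"
      using det by (metis real_sqrt_abs real_sqrt_mult real_sqrt_one)
  qed
  have bl: "bounded_linear f" if "linear f" for f :: "real^'n::finite \<Rightarrow> real^'m::finite"
    using that by (simp add: linear_conv_bounded_linear)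
  have mu: "0 < shrink_factor \<alpha> \<sigma> (w z)" for z by (rule shrink_factor_pos)
  have slope: "0 \<le> shrink_slope \<alpha> \<sigma> (w z)" for z using \<alpha> by (simp add: shrink_slope_def)
  have jac_pos: "0 < jac z" for z
    unfolding jac_def using mu[of z] slope[of z]
    by (intro mult_pos_pos add_pos_nonneg mult_nonneg_nonneg divide_nonneg_pos) auto
  have w': "(w has_derivative vsnd) (at z)" for z
    unfolding w_def using has_derivative_add[OF bounded_linear_imp_has_derivative[OF bl[OF linear_vsnd]] has_derivative_const]
    by simp
  have K: "(K has_derivative K' z) (at z)" for z
    unfolding K_def[abs_def] K'_def[abs_def]
    by (intro has_derivative_vjoin bounded_linear_imp_has_derivative bl linear_vfst
        has_derivative_compose[OF w' has_derivative_shrink[OF \<sigma>]])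
  have F_der: "(F has_derivative (\<lambda>h. whiten Q (K' z h))) (at z)" for z
    unfolding F_def[abs_def]
    using has_derivative_add[OF bounded_linear.has_derivative[OF bl[OF linear_whiten] K] has_derivative_const] by simp
  have w_cont: "continuous_on UNIV w"
    using w' has_derivative_continuous_on[of UNIV w "\<lambda>_. vsnd"] by auto
  have [measurable]: "w \<in> borel_measurable borel"
    by (rule borel_measurable_continuous_onI[OF w_cont])
  have [measurable]: "jac \<in> borel_measurable borel"
    unfolding jac_def[abs_def] shrink_slope_def shrink_factor_def by measurable
  have "distr (gaussI \<sigma>) borel F = density lborel (\<lambda>t. ennreal (f_inf \<alpha> \<sigma> Q \<gamma> t))"
    unfolding gaussI_eq[OF \<sigma>]
  proof (rule distr_density_change_of_variables(2)[where J = "\<lambda>z. ?W * jac z"])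
    show "(F has_derivative (\<lambda>h. whiten Q (K' z h))) (at z)" for z by (rule F_der)
    show "\<bar>det (matrix (\<lambda>h. whiten Q (K' z h)))\<bar> = ?W * jac z" for z
    proof -
      have "linear (K' z)" using K[of z] by (rule has_derivative_linear)
      then have "matrix (\<lambda>h. whiten Q (K' z h)) = matrix (whiten Q) ** matrix (K' z)"
        using matrix_compose[OF _ linear_whiten, of "K' z" Q] by (simp add: o_def)
      moreover have "det (matrix (K' z)) = jac z"
        unfolding K'_def[abs_def] jac_def using mu[of z] by (intro det_rank_one_update) simp
      ultimately show ?thesis using jac_pos[of z] by (simp add: det_mul abs_mult)
    qed
    show "0 < ?W * jac z" for z using W(1) jac_pos by simp
    show "?W * jac z * f_inf \<alpha> \<sigma> Q \<gamma> (F z) = gdens \<sigma> (mat 1) z" for z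
    proof -
      let ?m = "shrink_factor \<alpha> \<sigma> (w z)"
      let ?x = "1 + shrink_slope \<alpha> \<sigma> (w z) / ?m * (w z \<bullet> w z)"
      have x: "0 < ?x" using mu[of z] slope[of z] by (intro add_pos_nonneg mult_nonneg_nonneg divide_nonneg_pos) auto
      have c: "?m ^ CARD('b) * inverse ?m ^ CARD('b) = 1" "?x * inverse ?x = 1"
        using mu[of z] x by (simp_all flip: power_mult_distrib)
      have e: "exp (- (vfst z \<bullet> vfst z) / (2 * \<sigma>\<^sup>2)) * exp (- (vsnd z \<bullet> vsnd z) / (2 * \<sigma>\<^sup>2)) = exp (- (z \<bullet> z) / (2 * \<sigma>\<^sup>2))"
        by (simp add: inner_vec_sum[of z z] diff_divide_distrib add_divide_distrib flip: exp_add)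
      \<comment> \<open>Each Jacobian factor is paired with its reciprocal in \<open>f_inf\<close>;
        \<open>sqrt (det Q)\<close> is the reciprocal of \<open>?W\<close>.\<close>
      have "?W * jac z * f_inf \<alpha> \<sigma> Q \<gamma> (F z) =
          (2 * pi * \<sigma>\<^sup>2) powr (- real CARD('a + 'b) / 2) * (?W * sqrt (det Q)) *
          (?m ^ CARD('b) * inverse ?m ^ CARD('b)) * (?x * inverse ?x) *
          (exp (- (vfst z \<bullet> vfst z) / (2 * \<sigma>\<^sup>2)) * exp (- (vsnd z \<bullet> vsnd z) / (2 * \<sigma>\<^sup>2)))"
        unfolding F_def K_def jac_def w_def f_inf_whiten[OF \<sigma> \<alpha> Q] by (simp only: mult_ac)
      then show ?thesis unfolding c e W(2) by (simp add: gdens_def)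
    qed
    show "bij F"
    proof -
      have bs: "bij (shrink \<alpha> \<sigma> :: real^'b \<Rightarrow> real^'b)" by (rule bij_shrink[OF \<alpha> \<sigma>])
      let ?c = "msqrt (schur Q) *v \<gamma>"
      have "bij K"
        by (rule o_bij[of "\<lambda>y. vjoin (vfst y) (inv (shrink \<alpha> \<sigma>) (vsnd y) - ?c)"])
           (auto simp: fun_eq_iff K_def w_def inv_f_f[OF bij_is_inj[OF bs]] surj_f_inv_f[OF bij_is_surj[OF bs]])
      from bij_comp[OF bij_comp[OF this bij_whiten[OF Q]] bij_plus_left] show ?thesis
        unfolding F_def[abs_def] by (simp add: o_def)
    qed
    show "integrable lborel (gdens \<sigma> (mat 1) :: real^('a + 'b) \<Rightarrow> real)" by (rule integrable_gdens_mat_1[OF \<sigma>])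
    show "0 \<le> gdens \<sigma> (mat 1) x" for x :: "real^('a + 'b)" by (rule gdens_nonneg) simp
  qed auto
  moreover have "limit_law \<alpha> \<sigma> Q \<gamma> = distr (gaussI \<sigma>) borel F"
    unfolding limit_law_eq_avg_map[OF \<sigma> Q] avg_map_whiten[OF Q] F_def[abs_def] K_def w_def ..
  ultimately show ?thesis by simp
qed

theorem theorem7:
  fixes X :: "nat \<Rightarrow> nat \<Rightarrow> ('k1::finite + 'k2::finite) \<Rightarrow> real"
    and Q :: "real^('k1 + 'k2)^('k1 + 'k2)"
    and \<sigma> \<alpha> :: real
  assumes sigma_pos: "0 < \<sigma>"
    and alpha_pos: "0 < \<alpha>"
    and rank: "\<And>n. n \<ge> CARD('k1 + 'k2) \<Longrightarrow> full_col_rank X n"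
    and limQ: "(\<lambda>n. (1 / real n) *\<^sub>R gram X n) \<longlonglongrightarrow> Q"
    and Qpd: "pos_def Q"
  shows
    "(\<forall>\<beta> :: nat \<Rightarrow> real^('k1 + 'k2).
        filterlim (\<lambda>n. norm (sqrt (real n) *\<^sub>R vsnd (\<beta> n))) at_top sequentially \<longrightarrow>
        weak_conv (\<lambda>n. distr (PY X n (\<beta> n) \<sigma>) borel
                          (\<lambda>Y. sqrt (real n) *\<^sub>R (betaTilde \<alpha> \<sigma> X n Y - \<beta> n)))
                  (mvnormal (\<sigma>\<^sup>2 *\<^sub>R matrix_inv Q)))
     \<and>
     (\<forall>(\<beta> :: nat \<Rightarrow> real^('k1 + 'k2)) (\<gamma> :: real^'k2).
        (\<lambda>n. sqrt (real n) *\<^sub>R vsnd (\<beta> n)) \<longlonglongrightarrow> \<gamma> \<longrightarrow>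
        weak_conv (\<lambda>n. distr (PY X n (\<beta> n) \<sigma>) borel
                          (\<lambda>Y. sqrt (real n) *\<^sub>R (betaTilde \<alpha> \<sigma> X n Y - \<beta> n)))
                  (limit_law \<alpha> \<sigma> Q \<gamma>)
        \<and> limit_law \<alpha> \<sigma> Q \<gamma> = density lborel (\<lambda>t. ennreal (f_inf \<alpha> \<sigma> Q \<gamma> t)))"
proof (intro conjI allI impI)
  have pd: "\<forall>\<^sub>F n in sequentially. pos_def ((1 / real n) *\<^sub>R gram X n)"
    using eventually_ge_at_top[of "CARD('k1 + 'k2)"]
  proof eventually_elim
    case (elim n)
    have "0 < CARD('k1 + 'k2)" by simp
    then have "0 < n" using elim by linarith
    then show ?case using pos_def_gram[OF rank[OF elim]] by (intro pos_def_scale) auto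
  qed
  \<comment> \<open>Both claims differ only in the pointwise limit of \<open>avg_map\<close>
    supplied to this fact.\<close>
  note conv = weak_conv_betaTilde[OF sigma_pos rank limQ Qpd]
  fix \<beta> :: "nat \<Rightarrow> real^('k1 + 'k2)"
  {
    assume "filterlim (\<lambda>n. norm (sqrt (real n) *\<^sub>R vsnd (\<beta> n))) at_top sequentially"
    from tendsto_avg_map_at_infinity[OF limQ Qpd pd this alpha_pos sigma_pos]
    have "weak_conv (\<lambda>n. distr (PY X n (\<beta> n) \<sigma>) borel (\<lambda>Y. sqrt (real n) *\<^sub>R (betaTilde \<alpha> \<sigma> X n Y - \<beta> n)))
        (distr (density lborel (\<lambda>v. ennreal (gdens \<sigma> Q v))) borel (\<lambda>v. v))"
      by (intro conv) auto
    then show "weak_conv (\<lambda>n. distr (PY X n (\<beta> n) \<sigma>) borel (\<lambda>Y. sqrt (real n) *\<^sub>R (betaTilde \<alpha> \<sigma> X n Y - \<beta> n)))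
        (mvnormal (\<sigma>\<^sup>2 *\<^sub>R matrix_inv Q))"
      unfolding mvnormal_eq_gdens[OF sigma_pos Qpd] by (simp add: distr_id2)
  }
  {
    fix \<gamma> :: "real^'k2"
    assume "(\<lambda>n. sqrt (real n) *\<^sub>R vsnd (\<beta> n)) \<longlonglongrightarrow> \<gamma>"
    from tendsto_avg_map[OF limQ Qpd pd this]
    show "weak_conv (\<lambda>n. distr (PY X n (\<beta> n) \<sigma>) borel (\<lambda>Y. sqrt (real n) *\<^sub>R (betaTilde \<alpha> \<sigma> X n Y - \<beta> n)))
        (limit_law \<alpha> \<sigma> Q \<gamma>)"
      unfolding limit_law_eq_distr_gdens[OF sigma_pos Qpd] by (intro conv) auto
    show "limit_law \<alpha> \<sigma> Q \<gamma> = density lborel (\<lambda>t. ennreal (f_inf \<alpha> \<sigma> Q \<gamma> t))"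
      by (rule limit_law_density[OF sigma_pos alpha_pos Qpd])
  }
qed

end
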